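(* For all $n\ge 2$ and $1\le k\le n$, the melting ice cream scoop graph $IC_{n+1}^{(k)}$, obtained by deleting the edges between vertex $n+1$ and vertices $1,\dots,k$ from the complete graph $K_{n+1}$ on vertex set $\{1,\dots,n+1\}$, and its reverse graph $(IC_{n+1}^{(k)})^r$, are both appendable $(e)$-positive.
   Context: All graphs are finite and simple with nonempty vertex set. A labelled graph on $d$ vertices is a graph with vertex set $[d]=\{1,\dots,d\}$. The reverse graph $G^r$ of a labelled graph $G$ on $d$ vertices is obtained by relabelling each vertex $i$ as $d+1-i$. For a set partition $\pi$ of $[d]$, let $B_{\pi,i}$ be the block containing $i$, and let $e_\pi=\sum x_{i_1}\cdots x_{i_d}$ in noncommuting variables $x_1,x_2,\dots$, summed over all tuples $(i_1,\dots,i_d)$ of positive integers with $i_j\ne i_k$ whenever $j\neq k$ and $B_{\pi,j}=B_{\pi,k}$. The $e_\pi$, over set partitions $\pi$ of $[d]$, form a $\mathbb Q$-basis of $\mathrm{NCSym}^d$, the degree-$d$ part of the algebra of symmetric functions in noncommuting variables. For $d\ge 1$ let $\mathrm{type}(\pi)=(\lambda,b)$, where $b=|B_{\pi,d}|$ and $\lambda$ is the integer partition (possibly empty) formed by the sizes of the other blocks. $\mathrm{UBCSym}^d$ is the $\mathbb Q$-vector space with basis $\{e_{(\lambda,b)}\}$ over pairs of a partition $\lambda$ and an integer $b\ge 1$ with $|\lambda|+b=d$, and $\nu:\mathrm{NCSym}^d\to\mathrm{UBCSym}^d$ is the linear map with $\nu(e_\pi)=e_{\mathrm{type}(\pi)}$.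 For a labelled graph $G$ on $d$ vertices, $Y_G=\sum_\kappa x_{\kappa(1)}\cdots x_{\kappa(d)}\in\mathrm{NCSym}^d$, summed over all proper colourings $\kappa:[d]\to\mathbb Z_{>0}$ of $G$, and $y_G=\nu(Y_G)$. $G$ is $(e)$-positive if all coefficients of $y_G$ in the basis $\{e_{(\lambda,b)}\}$ are nonnegative. For labelled graphs $G$ on $n$ vertices and $H$ on $m$ vertices, the concatenation $G+H$ is the labelled graph on $[n+m-1]$ obtained by placing $G$ on labels $1,\dots,n$ and $H$ on labels $n,\dots,n+m-1$ (vertex $i$ of $H$ becoming $n-1+i$), so vertex $n$ of $G$ is identified with vertex $1$ of $H$. A labelled graph $H$ is appendable $(e)$-positive if $G+H$ is $(e)$-positive for every $(e)$-positive labelled graph $G$. *)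

theory Defs
  imports Complex_Main "HOL-Library.FuncSet" "HOL-Library.Disjoint_Sets"
    "HOL-Library.Multiset" "HOL-Library.Poly_Mapping"
    "HOL-Library.Function_Algebras"
begin

section \<open>Labelled graphs\<close>

text \<open>The vertex set of a labelled graph is \<open>{1..nverts G}\<close>; edges are two-element sets of
  vertices.\<close>

datatype lgraph = LGraph (nverts: nat) (edges: "nat set set")

definition complete_edges :: "nat \<Rightarrow> nat set set" where
  "complete_edges d = {{i, j} | i j. i \<in> {1..d} \<and> j \<in> {1..d} \<and> i \<noteq> j}"

definition labelled_graph :: "lgraph \<Rightarrow> bool" where
  "labelled_graph G \<longleftrightarrow> 1 \<le> nverts G \<and> edges G \<subseteq> complete_edges (nverts G)"

definition reverse_graph :: "lgraph \<Rightarrow> lgraph" where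
  "reverse_graph G = LGraph (nverts G) ((\<lambda>e. (\<lambda>i. nverts G + 1 - i) ` e) ` edges G)"

definition concat_graph :: "lgraph \<Rightarrow> lgraph \<Rightarrow> lgraph" where
  "concat_graph G H =
     LGraph (nverts G + nverts H - 1)
       (edges G \<union> (\<lambda>e. (\<lambda>i. nverts G - 1 + i) ` e) ` edges H)"

text \<open>\<open>ice_cream N k\<close> is the graph written $IC_N^{(k)}$, on \<open>N\<close> vertices.\<close>

definition ice_cream :: "nat \<Rightarrow> nat \<Rightarrow> lgraph" where
  "ice_cream N k = LGraph N (complete_edges N - {{i, N} | i. i \<in> {1..k}})"

section \<open>Power series in noncommuting variables\<close>

text \<open>A formal power series in noncommuting variables $x_1, x_2, \dots$ over the rationals is given
  by its coefficient function on words; the word \<open>[i\<^sub>1, \<dots>, i\<^sub>d]\<close> stands for the monomial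
  $x_{i_1} \cdots x_{i_d}$.\<close>

type_synonym nc_series = "nat list \<Rightarrow> rat"

definition nc_scale :: "rat \<Rightarrow> nc_series \<Rightarrow> nc_series" where
  "nc_scale c f = (\<lambda>w. c * f w)"

global_interpretation nc: vector_space nc_scale
  by unfold_locales (auto simp: nc_scale_def fun_eq_iff algebra_simps)

text \<open>\<open>monomial_sum d S\<close> is the possibly infinite sum of $x_{\kappa(1)} \cdots x_{\kappa(d)}$ over
  \<open>\<kappa> \<in> S\<close>. It is used for sets of functions that are extensional on \<open>{1..d}\<close>, so that
  different \<open>\<kappa>\<close> give different words.\<close>

definition monomial_sum :: "nat \<Rightarrow> (nat \<Rightarrow> nat) set \<Rightarrow> nc_series" where
  "monomial_sum d S = (\<lambda>w. of_nat (card {\<kappa> \<in> S. map \<kappa> [1..<Suc d] = w}))"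

definition set_partitions :: "nat \<Rightarrow> nat set set set" where
  "set_partitions d = {\<pi>. partition_on {1..d} \<pi>}"

definition block :: "nat set set \<Rightarrow> nat \<Rightarrow> nat set" where
  "block \<pi> i = (THE B. B \<in> \<pi> \<and> i \<in> B)"

definition nc_e :: "nat \<Rightarrow> nat set set \<Rightarrow> nc_series" where
  "nc_e d \<pi> = monomial_sum d
     {\<iota> \<in> {1..d} \<rightarrow>\<^sub>E {1..}.
        \<forall>j\<in>{1..d}. \<forall>k\<in>{1..d}. j \<noteq> k \<and> block \<pi> j = block \<pi> k \<longrightarrow> \<iota> j \<noteq> \<iota> k}"

definition proper_colourings :: "lgraph \<Rightarrow> (nat \<Rightarrow> nat) set" where
  "proper_colourings G =
     {\<kappa> \<in> {1..nverts G} \<rightarrow>\<^sub>E {1..}. \<forall>i j. {i, j} \<in> edges G \<longrightarrow> \<kappa> i \<noteq> \<kappa> j}"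

definition chromatic_Y :: "lgraph \<Rightarrow> nc_series" where
  "chromatic_Y G = monomial_sum (nverts G) (proper_colourings G)"

section \<open>The quotient map and positivity\<close>

definition type_index :: "nat \<Rightarrow> (nat multiset \<times> nat) set" where
  "type_index d = {(la, b). 0 \<notin># la \<and> 1 \<le> b \<and> sum_mset la + b = d}"

definition partition_type :: "nat \<Rightarrow> nat set set \<Rightarrow> nat multiset \<times> nat" where
  "partition_type d \<pi> =
     (image_mset card (mset_set (\<pi> - {block \<pi> d})), card (block \<pi> d))"

text \<open>UBCSym in degree \<open>d\<close> is the free vector space on \<open>type_index d\<close>, with
  \<open>Poly_Mapping.single (la, b) 1\<close> as the basis vector $e_{(\lambda,b)}$. The map \<open>nu d\<close>
  expands its argument in the basis of the $e_\pi$ of NCSym in degree \<open>d\<close> and sends each $e_\pi$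
  to $e_{\mathrm{type}(\pi)}$. Outside the span of the $e_\pi$ its value is 0, which is
  meaningless.\<close>

definition nu :: "nat \<Rightarrow> nc_series \<Rightarrow> (nat multiset \<times> nat) \<Rightarrow>\<^sub>0 rat" where
  "nu d f = (\<Sum>\<pi>\<in>set_partitions d.
     Poly_Mapping.single (partition_type d \<pi>)
       (nc.representation (nc_e d ` set_partitions d) f (nc_e d \<pi>)))"

definition chromatic_y :: "lgraph \<Rightarrow> (nat multiset \<times> nat) \<Rightarrow>\<^sub>0 rat" where
  "chromatic_y G = nu (nverts G) (chromatic_Y G)"

definition e_positive :: "lgraph \<Rightarrow> bool" where
  "e_positive G \<longleftrightarrow>
     (\<forall>t\<in>type_index (nverts G). 0 \<le> Poly_Mapping.lookup (chromatic_y G) t)"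

definition appendable_e_positive :: "lgraph \<Rightarrow> bool" where
  "appendable_e_positive H \<longleftrightarrow>
     labelled_graph H \<and>
     (\<forall>G. labelled_graph G \<and> e_positive G \<longrightarrow> e_positive (concat_graph G H))"

end

(* Let all variables but the last one of each word commute: a series f of degree d becomes, for each
   colour j, a symmetric polynomial in the remaining letters, and e_pi becomes the product of the
   c! e_c(X) over the block sizes c of lambda times (b-1)! e_(b-1)(X - x_j), where (lambda, b) is the
   type of pi.  On finitely many colours this factors through nu, and the images of the e_(lambda, b)
   remain independent, so the coefficients of y_G can be read off there.  Concatenation with H becomes
   an operator that is linear over symmetric polynomials, so only the cliques K_b have to be tested.

   For a clique of size b = p+1 glued to a scoop with n = q+2, the sum
     sum_{i ~= j} x_i e_p(X - x_i) e_q(X - x_j - x_i)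
   expands as sum_c rho_c e_c(X) e_(p+q+1-c)(X - x_j) with rho_c >= 0, where rho_c is glue_coeff.
   With s = n - k, the reversed scoop is a combination of this sum (for p+1) and one further product;
   the scoop itself also produces terms e_c(X) e_(N-c)(X) whose coefficients are only nonnegative
   after those of c and N-c are added. *)
theory Submission
  imports Defs "HOL-Combinatorics.Permutations" "HOL-Computational_Algebra.Polynomial"
begin

section \<open>Elementary symmetric functions of finitely many variables\<close>

text \<open>The obstacle is that \<open>nu\<close> is defined by an expansion in the e_pi, while a
  chromatic series comes as a sum over colourings. So the e_pi are proved independent, and every
  indicator of a condition on which letters of a word agree is put into their span; this gives
  \<open>nu\<close> its meaning on Y_G. After that no coefficient of y_G is computed: any
  nonnegative expansion of the commuted series suffices, since independence of the images leaves
  only one expansion.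

  The last letter stays apart for two reasons: the type of pi singles out the block of d, and d is
  the vertex where H is attached. Finitely many colours lose nothing because a word of length d has
  the same pattern of equal letters as some word over {1..d}. All sums are then finite, and the x_i
  can be arbitrary rationals instead of formal variables.

  The averaging for the scoop comes from a factor x_j that no sum absorbs: x_j e_r(X - x_j) =
  e_(r+1)(X) - e_(r+1)(X - x_j). The first part yields products e_c(X) e_(N-c)(X), which have b = 1,
  and there c and N - c name the same basis vector.\<close>

fun ehat :: "(nat \<Rightarrow> rat) \<Rightarrow> nat \<Rightarrow> nat set \<Rightarrow> rat" where
  "ehat x 0 I = 1"
| "ehat x (Suc c) I = (\<Sum>i\<in>I. x i * ehat x c (I - {i}))"

text \<open>A tuple of c + 1 distinct elements of \<open>I\<close> either omits \<open>i\<close> or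
  has \<open>i\<close> in exactly one of its c + 1 positions. The induction removes the first
  entry.\<close>

lemma ehat_remove:
  assumes "finite I" "i \<in> I"
  shows "ehat x (Suc c) I = ehat x (Suc c) (I - {i}) + of_nat (Suc c) * x i * ehat x c (I - {i})"
  using assms
proof (induction c arbitrary: I)
  case 0
  then show ?case by (simp add: sum.remove)
next
  case (Suc c)
  have "ehat x (Suc (Suc c)) I
      = x i * ehat x (Suc c) (I - {i}) + (\<Sum>k\<in>I - {i}. x k * ehat x (Suc c) (I - {k}))"
    using Suc.prems by (simp only: ehat.simps(2)[of x "Suc c"] sum.remove)
  also have "(\<Sum>k\<in>I - {i}. x k * ehat x (Suc c) (I - {k}))
      = (\<Sum>k\<in>I - {i}. x k * ehat x (Suc c) (I - {i} - {k})
          + of_nat (Suc c) * x i * (x k * ehat x c (I - {i} - {k})))"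
  proof (rule sum.cong)
    fix k assume "k \<in> I - {i}"
    moreover have "I - {k} - {i} = I - {i} - {k}" by auto
    ultimately show "x k * ehat x (Suc c) (I - {k}) = x k * ehat x (Suc c) (I - {i} - {k})
          + of_nat (Suc c) * x i * (x k * ehat x c (I - {i} - {k}))"
      using Suc.IH[of "I - {k}"] Suc.prems by (simp add: algebra_simps del: ehat.simps)
  qed simp
  also have "\<dots> = ehat x (Suc (Suc c)) (I - {i}) + of_nat (Suc c) * x i * ehat x (Suc c) (I - {i})"
    by (simp only: sum.distrib sum_distrib_left ehat.simps(2))
  finally show ?case by (simp add: algebra_simps del: ehat.simps)
qed

text \<open>\<open>ehat\<close> runs over ordered tuples of distinct elements, which is what
  colourings of a clique produce, so it is c! times the elementary symmetric polynomial. The product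
  identities are stated for the latter because their coefficients are then linear in c.\<close>

definition esym :: "(nat \<Rightarrow> rat) \<Rightarrow> nat \<Rightarrow> nat set \<Rightarrow> rat" where
  "esym x c I = ehat x c I / fact c"

lemma ehat_eq_esym: "ehat x c I = fact c * esym x c I"
  by (simp add: esym_def)

lemma esym_0 [simp]: "esym x 0 I = 1"
  by (simp add: esym_def)

lemma esym_remove:
  assumes "finite I" "i \<in> I"
  shows "esym x (Suc c) I = esym x (Suc c) (I - {i}) + x i * esym x c (I - {i})"
proof -
  have "fact (Suc c) * esym x (Suc c) I
      = fact (Suc c) * (esym x (Suc c) (I - {i}) + x i * esym x c (I - {i}))"
    using ehat_remove[OF assms, of x c]
    by (simp only: ehat_eq_esym) (simp add: algebra_simps)
  then show ?thesis by (simp del: fact_Suc)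
qed

text \<open>Each product of c + 1 distinct variables is counted once for every one of its
  factors.\<close>

lemma sum_esym_remove:
  "(\<Sum>i\<in>I. x i * esym x c (I - {i})) = of_nat (Suc c) * esym x (Suc c) I"
proof -
  have "fact c * (\<Sum>i\<in>I. x i * esym x c (I - {i})) = ehat x (Suc c) I"
    by (simp add: ehat_eq_esym[of x c] sum_distrib_left algebra_simps)
  also have "\<dots> = fact c * (of_nat (Suc c) * esym x (Suc c) I)"
    by (simp only: ehat_eq_esym fact_Suc) (simp add: algebra_simps del: ehat.simps)
  finally show ?thesis by simp
qed

text \<open>The induction shifts one unit of degree from the second factor to the first. Expressing
  one factor over all of \<open>I\<close> in the sums for (p + 1, q) and (p, q + 1) leaves the same
  remainder \<open>?D\<close>, so the two sums differ by (q - p) e_(p+1) e_(q+1), which is the new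
  summand c = p + 1.\<close>

lemma sum_esym_esym:
  assumes "finite I"
  shows "(\<Sum>i\<in>I. x i * esym x p (I - {i}) * esym x q (I - {i}))
      = (\<Sum>c\<le>p. of_int (int (p + q + 1) - 2 * int c) * esym x c I * esym x (p + q + 1 - c) I)"
proof (induction p arbitrary: q)
  case 0
  then show ?case using sum_esym_remove[of x q I] by simp
next
  case (Suc p)
  let ?D = "\<Sum>i\<in>I. x i * x i * esym x p (I - {i}) * esym x q (I - {i})"
  have "(\<Sum>i\<in>I. x i * esym x (Suc p) (I - {i}) * esym x q (I - {i}))
      = (\<Sum>i\<in>I. esym x (Suc p) I * (x i * esym x q (I - {i}))
           - x i * x i * esym x p (I - {i}) * esym x q (I - {i}))"
    by (intro sum.cong) (auto simp: esym_remove[OF assms] algebra_simps)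
  also have "\<dots> = of_nat (Suc q) * esym x (Suc p) I * esym x (Suc q) I - ?D"
    by (simp add: sum_subtractf sum_distrib_left[symmetric] sum_esym_remove)
  finally have 1: "(\<Sum>i\<in>I. x i * esym x (Suc p) (I - {i}) * esym x q (I - {i})) = \<dots>" .
  have "(\<Sum>i\<in>I. x i * esym x p (I - {i}) * esym x (Suc q) (I - {i}))
      = (\<Sum>i\<in>I. esym x (Suc q) I * (x i * esym x p (I - {i}))
           - x i * x i * esym x p (I - {i}) * esym x q (I - {i}))"
    by (intro sum.cong) (auto simp: esym_remove[OF assms] algebra_simps)
  also have "\<dots> = of_nat (Suc p) * esym x (Suc p) I * esym x (Suc q) I - ?D"
    by (simp add: sum_subtractf sum_distrib_left[symmetric] sum_esym_remove)
  finally have 2: "(\<Sum>i\<in>I. x i * esym x p (I - {i}) * esym x (Suc q) (I - {i})) = \<dots>" .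
  show ?case
    using 1 2 Suc.IH[of "Suc q"] by (simp add: algebra_simps)
qed

text \<open>With generating functions $E(z)$ over \<open>I\<close> and $G(z)$ over \<open>I - {j}\<close>, so that
  $E(z) = (1 + x_j z) G(z)$, this is $(z - w) G(z) G(w) = z G(z) E(w) - w E(z) G(w)$.\<close>

lemma esym_mult_remove:
  assumes "finite I" "j \<in> I"
  shows "esym x p (I - {j}) * esym x q (I - {j})
      = (\<Sum>c\<le>p + q. (of_bool (c \<le> p) - of_bool (q < c)) * esym x c I * esym x (p + q - c) (I - {j}))"
proof (induction p arbitrary: q)
  case 0
  have "(\<Sum>c\<le>q. (of_bool (c = 0) - of_bool (q < c)) * esym x c I * esym x (q - c) (I - {j}))
      = (\<Sum>c\<le>q. if c = 0 then esym x q (I - {j}) else 0)"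
    by (intro sum.cong) auto
  then show ?case by simp
next
  case (Suc p)
  let ?g = "\<lambda>c. esym x c (I - {j})" and ?e = "\<lambda>c. esym x c I"
  have "?g (Suc p) * ?g q = ?g p * ?g (Suc q) + ?e (Suc p) * ?g q - ?g p * ?e (Suc q)"
    by (simp add: esym_remove[OF assms] algebra_simps)
  also have "?g p * ?g (Suc q) = (\<Sum>c\<le>Suc (p + q). (of_bool (c \<le> p) - of_bool (Suc q < c)) * ?e c * ?g (Suc (p + q) - c))"
    using Suc.IH[of "Suc q"] by simp
  also have "?e (Suc p) * ?g q = (\<Sum>c\<le>Suc (p + q). of_bool (c = Suc p) * ?e c * ?g (Suc (p + q) - c))"
    by (simp add: of_bool_def if_distrib[of "\<lambda>z. z * _"] sum.delta cong: if_cong del: sum.atMost_Suc)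
  also have "?g p * ?e (Suc q) = (\<Sum>c\<le>Suc (p + q). of_bool (c = Suc q) * ?e c * ?g (Suc (p + q) - c))"
    by (simp add: of_bool_def if_distrib[of "\<lambda>z. z * _"] sum.delta cong: if_cong del: sum.atMost_Suc)
  finally show ?case
    unfolding sum.distrib[symmetric] sum_subtractf[symmetric] add_Suc
    by (rule trans) (intro sum.cong; auto simp: algebra_simps of_bool_def)
qed

text \<open>The same shift of degree as in \<open>sum_esym_esym\<close>, now with one factor over
  \<open>I\<close> and one over \<open>I - {j}\<close>. Since i = j is excluded, the difference of
  the two sums also contains a product of two factors over \<open>I - {j}\<close>, which
  \<open>esym_mult_remove\<close> brings back to the required form.\<close>

lemma sum_esym_esym_remove:
  assumes "finite I" "j \<in> I"
  shows "(\<Sum>i\<in>I - {j}. x i * esym x p (I - {i}) * esym x q (I - {j} - {i}))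
      = (\<Sum>c\<le>p + q + 1. of_int ((if c \<le> p then int q + 1 - int c else 0)
           + (if q + 2 \<le> c then int c - int q - 1 else 0))
           * esym x c I * esym x (p + q + 1 - c) (I - {j}))"
proof (induction p arbitrary: q)
  case 0
  have "(\<Sum>i\<in>I - {j}. x i * esym x q (I - {j} - {i})) = of_nat (Suc q) * esym x (Suc q) (I - {j})"
    by (rule sum_esym_remove)
  also have "\<dots> = (\<Sum>c\<le>Suc q. if c = 0 then of_nat (Suc q) * esym x (Suc q) (I - {j}) else 0)"
    by (simp del: sum.atMost_Suc)
  also have "\<dots> = (\<Sum>c\<le>0 + q + 1. of_int ((if c \<le> 0 then int q + 1 - int c else 0)
           + (if q + 2 \<le> c then int c - int q - 1 else 0))
           * esym x c I * esym x (0 + q + 1 - c) (I - {j}))"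
    by (intro sum.cong) auto
  finally show ?case by simp
next
  case (Suc p)
  let ?J = "I - {j}"
  let ?g = "\<lambda>c. esym x c ?J" and ?e = "\<lambda>c. esym x c I"
  let ?D = "\<Sum>i\<in>?J. x i * x i * esym x p (I - {i}) * esym x q (?J - {i})"
  have fin: "finite ?J" using assms by simp
  have "(\<Sum>i\<in>?J. x i * esym x (Suc p) (I - {i}) * esym x q (?J - {i}))
      = (\<Sum>i\<in>?J. ?e (Suc p) * (x i * esym x q (?J - {i}))
           - x i * x i * esym x p (I - {i}) * esym x q (?J - {i}))"
    by (intro sum.cong) (auto simp: esym_remove[OF assms(1), of _ x p] algebra_simps)
  also have "\<dots> = of_nat (Suc q) * ?e (Suc p) * ?g (Suc q) - ?D"
    by (simp add: sum_subtractf sum_distrib_left[symmetric] sum_esym_remove)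
  finally have 1: "(\<Sum>i\<in>?J. x i * esym x (Suc p) (I - {i}) * esym x q (?J - {i})) = \<dots>" .
  have "(\<Sum>i\<in>?J. x i * esym x p (I - {i}) * esym x (Suc q) (?J - {i}))
      = (\<Sum>i\<in>?J. ?g (Suc q) * (x i * esym x p (I - {i}))
           - x i * x i * esym x p (I - {i}) * esym x q (?J - {i}))"
    by (intro sum.cong) (auto simp: esym_remove[OF fin, of _ x q] algebra_simps)
  also have "\<dots> = ?g (Suc q) * (\<Sum>i\<in>?J. x i * esym x p (I - {i})) - ?D"
    by (simp add: sum_subtractf sum_distrib_left[symmetric])
  \<comment> \<open>The summand i = j of the full sum is missing here; the next step eliminates its
    x_j.\<close>
  also have "(\<Sum>i\<in>?J. x i * esym x p (I - {i})) = of_nat (Suc p) * ?e (Suc p) - x j * ?g p"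
    using sum_esym_remove[of x p I] by (simp add: sum.remove[OF assms])
  also have "x j * ?g p = ?e (Suc p) - ?g (Suc p)"
    using esym_remove[OF assms, of x p] by simp
  finally have 2: "(\<Sum>i\<in>?J. x i * esym x p (I - {i}) * esym x (Suc q) (?J - {i}))
     = ?g (Suc q) * (of_nat (Suc p) * ?e (Suc p) - (?e (Suc p) - ?g (Suc p))) - ?D" .
  have "(\<Sum>i\<in>?J. x i * esym x (Suc p) (I - {i}) * esym x q (?J - {i}))
     = (\<Sum>i\<in>?J. x i * esym x p (I - {i}) * esym x (Suc q) (?J - {i}))
       + of_int (int q + 1 - int p) * ?e (Suc p) * ?g (Suc q) - ?g (Suc p) * ?g (Suc q)"
    unfolding 1 2 by (simp add: algebra_simps)
  also have "?g (Suc p) * ?g (Suc q) = (\<Sum>c\<le>p + Suc q + 1.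
      (of_bool (c \<le> Suc p) - of_bool (Suc q < c)) * ?e c * ?g (p + Suc q + 1 - c))"
    using esym_mult_remove[OF assms, of x "Suc p" "Suc q"] by simp
  also have "of_int (int q + 1 - int p) * ?e (Suc p) * ?g (Suc q)
      = (\<Sum>c\<le>p + Suc q + 1. if c = Suc p then of_int (int q + 1 - int p) * ?e (Suc p) * ?g (Suc q) else 0)"
    by (simp del: sum.atMost_Suc)
  also note Suc.IH[of "Suc q"]
  finally show ?case
    unfolding sum.distrib[symmetric] sum_subtractf[symmetric]
  proof (rule trans, intro sum.cong refl)
    fix c
    define A B where "A = (if c \<le> p then int (Suc q) + 1 - int c else 0)
        + (if Suc q + 2 \<le> c then int c - int (Suc q) - 1 else 0)"
      and "B = (if c \<le> Suc p then int q + 1 - int c else 0) + (if q + 2 \<le> c then int c - int q - 1 else 0)"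
    \<comment> \<open>\<open>A\<close> and \<open>B\<close> are the coefficients for (p, q + 1) and
      (p + 1, q). The correction lowers the coefficients with c <= p + 1 by one and raises those
      with c >= q + 2 by one; the middle term supplies the summand that enters at c = p + 1.\<close>
    have "A + (if c = Suc p then int q + 1 - int p else 0) - (of_bool (c \<le> Suc p) - of_bool (Suc q < c)) = B"
      unfolding A_def B_def by (auto simp: of_bool_def)
    then have B: "of_int B = of_int A + (if c = Suc p then of_int (int q + 1 - int p) else 0)
        - (of_bool (c \<le> Suc p) - of_bool (Suc q < c) :: rat)"
      by (auto simp: of_bool_def split: if_splits)
    show "of_int A * ?e c * ?g (p + Suc q + 1 - c)
        + (if c = Suc p then of_int (int q + 1 - int p) * ?e (Suc p) * ?g (Suc q) else 0)
        - (of_bool (c \<le> Suc p) - of_bool (Suc q < c)) * ?e c * ?g (p + Suc q + 1 - c)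
        = of_int B * ?e c * ?g (Suc p + q + 1 - c)"
      unfolding B by (auto simp: algebra_simps)
  qed simp
qed

section \<open>Weighted sums over colourings\<close>

text \<open>Only the vertices in \<open>A\<close> carry weight. A vertex outside \<open>A\<close>
  whose colour is prescribed by a function update inside \<open>F\<close> therefore contributes no
  variable.\<close>

definition wsum :: "nat set \<Rightarrow> (nat \<Rightarrow> rat) \<Rightarrow> nat set \<Rightarrow> ((nat \<Rightarrow> nat) \<Rightarrow> rat) \<Rightarrow> rat" where
  "wsum C x A F = (\<Sum>\<kappa>\<in>A \<rightarrow>\<^sub>E C. F \<kappa> * (\<Prod>v\<in>A. x (\<kappa> v)))"

lemma wsum_cong:
  "(\<And>\<kappa>. \<kappa> \<in> A \<rightarrow>\<^sub>E C \<Longrightarrow> F \<kappa> = G \<kappa>) \<Longrightarrow> wsum C x A F = wsum C x A G"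
  by (simp add: wsum_def cong: sum.cong)

lemma wsum_empty [simp]: "wsum C x {} F = F (\<lambda>_. undefined)"
  by (simp add: wsum_def)

lemma wsum_zero [simp]: "wsum C x A (\<lambda>_. 0) = 0"
  by (simp add: wsum_def)

lemma wsum_diff: "wsum C x A (\<lambda>\<kappa>. F \<kappa> - G \<kappa>) = wsum C x A F - wsum C x A G"
  by (simp add: wsum_def algebra_simps sum_subtractf)

lemma wsum_sum: "wsum C x A (\<lambda>\<kappa>. \<Sum>s\<in>S. F s \<kappa>) = (\<Sum>s\<in>S. wsum C x A (F s))"
proof -
  have "wsum C x A (\<lambda>\<kappa>. \<Sum>s\<in>S. F s \<kappa>) = (\<Sum>\<kappa>\<in>A \<rightarrow>\<^sub>E C. \<Sum>s\<in>S. F s \<kappa> * (\<Prod>v\<in>A. x (\<kappa> v)))"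
    unfolding wsum_def sum_distrib_right ..
  also have "\<dots> = (\<Sum>s\<in>S. wsum C x A (F s))"
    unfolding wsum_def by (rule sum.swap)
  finally show ?thesis .
qed

lemma wsum_cmult: "wsum C x A (\<lambda>\<kappa>. c * F \<kappa>) = c * wsum C x A F"
  by (simp add: wsum_def sum_distrib_left algebra_simps)

lemma wsum_insert:
  assumes "finite A" "v \<notin> A"
  shows "wsum C x (insert v A) F = (\<Sum>i\<in>C. x i * wsum C x A (\<lambda>\<kappa>. F (\<kappa>(v := i))))"
proof -
  have "wsum C x (insert v A) F
      = (\<Sum>p\<in>C \<times> (A \<rightarrow>\<^sub>E C). F ((snd p)(v := fst p)) * (\<Prod>u\<in>insert v A. x (((snd p)(v := fst p)) u)))"
    unfolding wsum_def PiE_insert_eq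
    by (subst sum.reindex) (use assms inj_combinator[of v A "\<lambda>_. C"] in \<open>auto simp: case_prod_unfold\<close>)
  also have "\<dots> = (\<Sum>p\<in>C \<times> (A \<rightarrow>\<^sub>E C). x (fst p) * (F ((snd p)(v := fst p)) * (\<Prod>u\<in>A. x (snd p u))))"
  proof (rule sum.cong)
    fix p assume "p \<in> C \<times> (A \<rightarrow>\<^sub>E C)"
    have "(\<Prod>u\<in>A. x (((snd p)(v := fst p)) u)) = (\<Prod>u\<in>A. x (snd p u))"
      using assms by (intro prod.cong) auto
    then show "F ((snd p)(v := fst p)) * (\<Prod>u\<in>insert v A. x (((snd p)(v := fst p)) u))
        = x (fst p) * (F ((snd p)(v := fst p)) * (\<Prod>u\<in>A. x (snd p u)))"
      using assms by simp
  qed simp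
  also have "\<dots> = (\<Sum>i\<in>C. x i * wsum C x A (\<lambda>\<kappa>. F (\<kappa>(v := i))))"
    unfolding wsum_def sum_distrib_left sum.cartesian_product by (simp add: case_prod_unfold)
  finally show ?thesis .
qed

text \<open>Disjoint vertex sets are coloured independently. On the right \<open>F\<close> and
  \<open>G\<close> see colourings that are \<open>undefined\<close> off their own set; the two
  dependence hypotheses say that this does not matter.\<close>

lemma wsum_Un:
  assumes "finite A" "finite B" "A \<inter> B = {}"
    and "\<And>\<kappa> \<kappa>'. (\<And>v. v \<in> A \<Longrightarrow> \<kappa> v = \<kappa>' v) \<Longrightarrow> F \<kappa> = F \<kappa>'"
    and "\<And>\<kappa> \<kappa>'. (\<And>v. v \<in> B \<Longrightarrow> \<kappa> v = \<kappa>' v) \<Longrightarrow> G \<kappa> = G \<kappa>'"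
  shows "wsum C x (A \<union> B) (\<lambda>\<kappa>. F \<kappa> * G \<kappa>) = wsum C x A F * wsum C x B G"
  using assms(1,3,4)
proof (induction A arbitrary: F)
  case empty
  have "F \<kappa> = F (\<lambda>_. undefined)" for \<kappa> by (rule empty.prems) simp
  then have "(\<lambda>\<kappa>. F \<kappa> * G \<kappa>) = (\<lambda>\<kappa>. F (\<lambda>_. undefined) * G \<kappa>)" by metis
  then show ?case by (simp add: wsum_cmult)
next
  case (insert v A)
  have "wsum C x (insert v (A \<union> B)) (\<lambda>\<kappa>. F \<kappa> * G \<kappa>)
      = (\<Sum>i\<in>C. x i * wsum C x (A \<union> B) (\<lambda>\<kappa>. F (\<kappa>(v := i)) * G (\<kappa>(v := i))))"
    using insert.hyps insert.prems(1) assms(2) by (intro wsum_insert) auto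
  also have "\<dots> = (\<Sum>i\<in>C. x i * (wsum C x A (\<lambda>\<kappa>. F (\<kappa>(v := i))) * wsum C x B G))"
  proof (intro sum.cong refl arg_cong2[where f = "(*)"])
    fix i
    have "G (\<kappa>(v := i)) = G \<kappa>" for \<kappa>
      using insert.prems(1) by (intro assms(5)) auto
    then have "wsum C x (A \<union> B) (\<lambda>\<kappa>. F (\<kappa>(v := i)) * G (\<kappa>(v := i)))
        = wsum C x (A \<union> B) (\<lambda>\<kappa>. F (\<kappa>(v := i)) * G \<kappa>)"
      by simp
    also have "\<dots> = wsum C x A (\<lambda>\<kappa>. F (\<kappa>(v := i))) * wsum C x B G"
    proof (rule insert.IH)
      show "F (\<kappa>(v := i)) = F (\<kappa>'(v := i))" if "\<And>v. v \<in> A \<Longrightarrow> \<kappa> v = \<kappa>' v" for \<kappa> \<kappa>'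
        using that by (intro insert.prems(2)) auto
    qed (use insert.prems(1) assms(5) in auto)
    finally show "wsum C x (A \<union> B) (\<lambda>\<kappa>. F (\<kappa>(v := i)) * G (\<kappa>(v := i)))
        = wsum C x A (\<lambda>\<kappa>. F (\<kappa>(v := i))) * wsum C x B G" .
  qed
  also have "\<dots> = wsum C x (insert v A) F * wsum C x B G"
    using insert.hyps by (simp add: wsum_insert sum_distrib_right mult.assoc)
  finally show ?case by simp
qed

text \<open>Giving colour i to one vertex removes i from the colours left for the others, which is
  the recursion of \<open>ehat\<close>.\<close>

lemma wsum_inj:
  assumes "finite T" "I \<subseteq> C" "finite C"
  shows "wsum C x T (\<lambda>\<kappa>. of_bool (inj_on \<kappa> T \<and> \<kappa> ` T \<subseteq> I)) = ehat x (card T) I"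
  using assms(1,2)
proof (induction T arbitrary: I)
  case empty
  then show ?case by simp
next
  case (insert v T)
  have *: "inj_on (\<kappa>(v := i)) (insert v T) \<and> (\<kappa>(v := i)) ` insert v T \<subseteq> I
      \<longleftrightarrow> i \<in> I \<and> inj_on \<kappa> T \<and> \<kappa> ` T \<subseteq> I - {i}" for \<kappa> i
    using insert.hyps by (auto simp: inj_on_def)
  have "wsum C x (insert v T) (\<lambda>\<kappa>. of_bool (inj_on \<kappa> (insert v T) \<and> \<kappa> ` insert v T \<subseteq> I))
      = (\<Sum>i\<in>C. if i \<in> I then x i * ehat x (card T) (I - {i}) else 0)"
  proof (unfold wsum_insert[OF insert.hyps] *, intro sum.cong refl)
    fix i
    have "I - {i} \<subseteq> C" using insert.prems by auto
    from insert.IH[OF this]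
    show "x i * wsum C x T (\<lambda>\<kappa>. of_bool (i \<in> I \<and> inj_on \<kappa> T \<and> \<kappa> ` T \<subseteq> I - {i}))
        = (if i \<in> I then x i * ehat x (card T) (I - {i}) else 0)"
      by auto
  qed
  also have "\<dots> = (\<Sum>i\<in>I. x i * ehat x (card T) (I - {i}))"
    using insert.prems assms(3) by (simp add: sum.inter_restrict[symmetric] Int_absorb1)
  finally show ?case using insert.hyps by simp
qed

lemma wsum_inj_avoiding:
  assumes "finite T" "S \<subseteq> T" "I \<subseteq> C" "finite C"
  shows "wsum C x T (\<lambda>\<kappa>. of_bool (inj_on \<kappa> T \<and> \<kappa> ` T \<subseteq> I \<and> j \<notin> \<kappa> ` S))
    = ehat x (card T) I - (if j \<in> I then of_nat (card S) * x j * ehat x (card T - 1) (I - {j}) else 0)"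
proof -
  let ?P = "\<lambda>\<kappa>. inj_on \<kappa> T \<and> \<kappa> ` T \<subseteq> I"
  have finS: "finite S" using assms finite_subset by blast
  \<comment> \<open>An injective colouring takes the value \<open>j\<close> at most once, so the
    subtracted sum is 0 or 1.\<close>
  have ind: "(of_bool (?P \<kappa> \<and> j \<notin> \<kappa> ` S) :: rat) = of_bool (?P \<kappa>) - (\<Sum>u\<in>S. of_bool (?P \<kappa> \<and> \<kappa> u = j))" for \<kappa>
  proof (cases "?P \<kappa> \<and> j \<in> \<kappa> ` S")
    case True
    then obtain u where u: "u \<in> S" "j = \<kappa> u" by auto
    have "(\<Sum>w\<in>S. of_bool (?P \<kappa> \<and> \<kappa> w = j) :: rat) = (\<Sum>w\<in>S. if w = u then 1 else 0)"
      using True u assms(2) by (intro sum.cong) (auto simp: inj_on_def)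
    then show ?thesis using True u finS by simp
  next
    case False
    then have "(\<Sum>u\<in>S. of_bool (?P \<kappa> \<and> \<kappa> u = j) :: rat) = 0" by (intro sum.neutral) auto
    then show ?thesis using False by auto
  qed
  have one: "wsum C x T (\<lambda>\<kappa>. of_bool (?P \<kappa> \<and> \<kappa> u = j))
      = (if j \<in> I then x j * ehat x (card T - 1) (I - {j}) else 0)" if "u \<in> S" for u
  proof -
    from that assms(2) have "u \<in> T" by auto
    then obtain T' where T: "T = insert u T'" "u \<notin> T'"
      by (rule Set.set_insert)
    have fin: "finite T'" using T(1) assms(1) by simp
    have *: "(inj_on (\<kappa>(u := i)) T \<and> (\<kappa>(u := i)) ` T \<subseteq> I) \<and> (\<kappa>(u := i)) u = j
      \<longleftrightarrow> i = j \<and> j \<in> I \<and> inj_on \<kappa> T' \<and> \<kappa> ` T' \<subseteq> I - {j}" for \<kappa> i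
      using T(2) unfolding T(1) by (auto simp: inj_on_def)
    have "wsum C x T (\<lambda>\<kappa>. of_bool (?P \<kappa> \<and> \<kappa> u = j))
       = (\<Sum>i\<in>C. x i * wsum C x T' (\<lambda>\<kappa>. of_bool (?P (\<kappa>(u := i)) \<and> (\<kappa>(u := i)) u = j)))"
      using wsum_insert[OF fin T(2), of C x "\<lambda>\<kappa>. of_bool (?P \<kappa> \<and> \<kappa> u = j)"] T(1) by simp
    also have "\<dots> = (\<Sum>i\<in>C. if i = j then (if j \<in> I then x j * wsum C x T'
        (\<lambda>\<kappa>. of_bool (inj_on \<kappa> T' \<and> \<kappa> ` T' \<subseteq> I - {j})) else 0) else 0)"
      unfolding * by (intro sum.cong) auto
    also have "\<dots> = (if j \<in> I then x j * wsum C x T'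
        (\<lambda>\<kappa>. of_bool (inj_on \<kappa> T' \<and> \<kappa> ` T' \<subseteq> I - {j})) else 0)"
      using assms by (auto simp: sum.delta)
    also have "wsum C x T' (\<lambda>\<kappa>. of_bool (inj_on \<kappa> T' \<and> \<kappa> ` T' \<subseteq> I - {j})) = ehat x (card T') (I - {j})"
      using assms by (intro wsum_inj[OF fin]) auto
    also have "card T' = card T - 1"
      using T fin by simp
    finally show ?thesis .
  qed
  have "wsum C x T (\<lambda>\<kappa>. of_bool (?P \<kappa> \<and> j \<notin> \<kappa> ` S))
      = wsum C x T (\<lambda>\<kappa>. of_bool (?P \<kappa>)) - (\<Sum>u\<in>S. wsum C x T (\<lambda>\<kappa>. of_bool (?P \<kappa> \<and> \<kappa> u = j)))"
    unfolding ind wsum_diff wsum_sum ..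
  then show ?thesis
    using one wsum_inj[OF assms(1,3,4)] by (simp add: conj_assoc)
qed

lemma wsum_inj_blocks:
  assumes "finite P" "disjoint P" "\<And>B. B \<in> P \<Longrightarrow> finite B" "finite C"
  shows "wsum C x (\<Union>P) (\<lambda>\<kappa>. of_bool (\<forall>B\<in>P. inj_on \<kappa> B)) = (\<Prod>B\<in>P. ehat x (card B) C)"
  using assms(1-3)
proof (induction P)
  case empty
  then show ?case by simp
next
  case (insert B P)
  have dis: "B \<inter> \<Union>P = {}"
    using insert.prems(1) insert.hyps by (auto simp: disjoint_def)
  have "wsum C x (B \<union> \<Union>P) (\<lambda>\<kappa>. of_bool (inj_on \<kappa> B) * of_bool (\<forall>B\<in>P. inj_on \<kappa> B))
      = wsum C x B (\<lambda>\<kappa>. of_bool (inj_on \<kappa> B)) * wsum C x (\<Union>P) (\<lambda>\<kappa>. of_bool (\<forall>B\<in>P. inj_on \<kappa> B))"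
  proof (rule wsum_Un)
    show "of_bool (inj_on \<kappa> B) = (of_bool (inj_on \<kappa>' B) :: rat)"
      if "\<And>v. v \<in> B \<Longrightarrow> \<kappa> v = \<kappa>' v" for \<kappa> \<kappa>' :: "nat \<Rightarrow> nat"
      using that by (simp add: inj_on_def)
    show "of_bool (\<forall>B\<in>P. inj_on \<kappa> B) = (of_bool (\<forall>B\<in>P. inj_on \<kappa>' B) :: rat)"
      if "\<And>v. v \<in> \<Union>P \<Longrightarrow> \<kappa> v = \<kappa>' v" for \<kappa> \<kappa>' :: "nat \<Rightarrow> nat"
    proof -
      have "inj_on \<kappa> B = inj_on \<kappa>' B" if "B \<in> P" for B
        using \<open>\<And>v. v \<in> \<Union>P \<Longrightarrow> \<kappa> v = \<kappa>' v\<close> that by (intro inj_on_cong) auto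
      then show ?thesis by simp
    qed
  qed (use insert dis in auto)
  also have "wsum C x B (\<lambda>\<kappa>. of_bool (inj_on \<kappa> B)) = ehat x (card B) C"
    using wsum_inj[of B C C x] insert.prems assms(4)
    by (subst wsum_cong[where G = "\<lambda>\<kappa>. of_bool (inj_on \<kappa> B \<and> \<kappa> ` B \<subseteq> C)"]) (auto simp: PiE_def Pi_def)
  also have "wsum C x (\<Union>P) (\<lambda>\<kappa>. of_bool (\<forall>B\<in>P. inj_on \<kappa> B)) = (\<Prod>B\<in>P. ehat x (card B) C)"
    using insert by (intro insert.IH) (auto simp: disjoint_def)
  finally show ?case
    using insert.hyps by (simp flip: of_bool_conj)
qed

section \<open>Series that depend only on equalities between letters\<close>

text \<open>Vertex i corresponds to list position i - 1. The letter 0 is excluded because the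
  variables start at x_1.\<close>

definition word_indicator :: "nat \<Rightarrow> ((nat \<Rightarrow> nat) \<Rightarrow> bool) \<Rightarrow> nc_series" where
  "word_indicator d P = (\<lambda>w. of_bool (length w = d \<and> 0 \<notin> set w \<and> P (\<lambda>i. w ! (i - 1))))"

lemma monomial_sum_eq_word_indicator:
  assumes "\<And>\<kappa> \<kappa>'. (\<And>i. i \<in> {1..d} \<Longrightarrow> \<kappa> i = \<kappa>' i) \<Longrightarrow> P \<kappa> = P \<kappa>'"
  shows "monomial_sum d {\<kappa> \<in> {1..d} \<rightarrow>\<^sub>E {1..}. P \<kappa>} = word_indicator d P"
proof
  fix w :: "nat list"
  let ?l = "\<lambda>i. w ! (i - 1)"
  let ?A = "{\<kappa> \<in> {\<kappa> \<in> {1..d} \<rightarrow>\<^sub>E {1..}. P \<kappa>}. map \<kappa> [1..<Suc d] = w}"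
  have word: "length w = d" "\<kappa> = restrict ?l {1..d}" if "map \<kappa> [1..<Suc d] = w" "\<kappa> \<in> {1..d} \<rightarrow>\<^sub>E {1..}" for \<kappa>
  proof -
    show "length w = d" using that(1) by auto
    show "\<kappa> = restrict ?l {1..d}"
    proof
      fix i show "\<kappa> i = restrict ?l {1..d} i"
        using that by (cases "i \<in> {1..d}") (auto simp: PiE_def extensional_def simp del: upt_Suc)
    qed
  qed
  \<comment> \<open>A word determines the extensional function that spells it, so every coefficient
    is 0 or 1.\<close>
  have "?A = (if length w = d \<and> 0 \<notin> set w \<and> P ?l then {restrict ?l {1..d}} else {})"
  proof (cases "length w = d \<and> 0 \<notin> set w \<and> P ?l")
    case True
    have "map (restrict ?l {1..d}) [1..<Suc d] = w"
      using True by (intro nth_equalityI) (auto simp del: upt_Suc)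
    moreover have "restrict ?l {1..d} \<in> {1..d} \<rightarrow>\<^sub>E {1..}"
    proof -
      have "Suc 0 \<le> w ! (i - 1)" if "i \<in> {1..d}" for i
      proof -
        have "w ! (i - 1) \<in> set w" using that True by auto
        then show ?thesis using True by (metis not0_implies_Suc Suc_le_eq zero_less_Suc)
      qed
      then show ?thesis by auto
    qed
    moreover have "P (restrict ?l {1..d})"
      using True assms[of "restrict ?l {1..d}" ?l] by auto
    ultimately have "restrict ?l {1..d} \<in> ?A" by blast
    then show ?thesis using word True by auto
  next
    case False
    have "\<kappa> \<notin> ?A" for \<kappa>
    proof
      assume k: "\<kappa> \<in> ?A"
      then have "length w = d" "\<kappa> = restrict ?l {1..d}" using word by auto
      moreover have "0 \<notin> set w"
      proof
        assume "0 \<in> set w"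
        then obtain i where "i \<in> {1..d}" "\<kappa> i = 0" using k by (auto simp: less_Suc_eq_le simp del: upt_Suc)
        moreover have "\<kappa> i \<in> {1..}" using k \<open>i \<in> {1..d}\<close> by blast
        ultimately show False by simp
      qed
      moreover have "P ?l" using k \<open>\<kappa> = restrict ?l {1..d}\<close> assms[of \<kappa> ?l] by auto
      ultimately show False using False by blast
    qed
    then show ?thesis using False by auto
  qed
  then show "monomial_sum d {\<kappa> \<in> {1..d} \<rightarrow>\<^sub>E {1..}. P \<kappa>} w = word_indicator d P w"
    by (auto simp: monomial_sum_def word_indicator_def)
qed

lemma block_eq:
  assumes "partition_on A \<pi>" "B \<in> \<pi>" "i \<in> B"
  shows "block \<pi> i = B"
  unfolding block_def using assms
  by (intro the_equality) (auto simp: partition_on_def disjoint_def)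

lemma partition_block:
  assumes "partition_on A \<pi>" "i \<in> A"
  shows "block \<pi> i \<in> \<pi>" "i \<in> block \<pi> i"
proof -
  obtain B where "B \<in> \<pi>" "i \<in> B" using assms by (auto simp: partition_on_def)
  then show "block \<pi> i \<in> \<pi>" "i \<in> block \<pi> i" using block_eq[OF assms(1)] by auto
qed

lemma nc_e_eq_word_indicator:
  assumes "partition_on {1..d} \<pi>"
  shows "nc_e d \<pi> = word_indicator d (\<lambda>\<kappa>. \<forall>B\<in>\<pi>. inj_on \<kappa> B)"
proof -
  have sub: "B \<subseteq> {1..d}" if "B \<in> \<pi>" for B using assms that by (auto simp: partition_on_def)
  have "(\<forall>j\<in>{1..d}. \<forall>k\<in>{1..d}. j \<noteq> k \<and> block \<pi> j = block \<pi> k \<longrightarrow> \<kappa> j \<noteq> \<kappa> k)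
      \<longleftrightarrow> (\<forall>B\<in>\<pi>. inj_on \<kappa> B)" for \<kappa> :: "nat \<Rightarrow> nat"
  proof
    assume L: "\<forall>j\<in>{1..d}. \<forall>k\<in>{1..d}. j \<noteq> k \<and> block \<pi> j = block \<pi> k \<longrightarrow> \<kappa> j \<noteq> \<kappa> k"
    show "\<forall>B\<in>\<pi>. inj_on \<kappa> B"
    proof (intro ballI inj_onI)
      fix B j k assume B: "B \<in> \<pi>" "j \<in> B" "k \<in> B" "\<kappa> j = \<kappa> k"
      then have "block \<pi> j = block \<pi> k" using block_eq[OF assms] by metis
      then show "j = k" using L sub[OF B(1)] B by blast
    qed
  next
    assume R: "\<forall>B\<in>\<pi>. inj_on \<kappa> B"
    show "\<forall>j\<in>{1..d}. \<forall>k\<in>{1..d}. j \<noteq> k \<and> block \<pi> j = block \<pi> k \<longrightarrow> \<kappa> j \<noteq> \<kappa> k"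
    proof (intro ballI impI)
      fix j k assume jk: "j \<in> {1..d}" "k \<in> {1..d}" "j \<noteq> k \<and> block \<pi> j = block \<pi> k"
      then have "j \<in> block \<pi> j" "k \<in> block \<pi> j" "inj_on \<kappa> (block \<pi> j)"
        using R partition_block[OF assms jk(1)] partition_block[OF assms jk(2)] by simp_all
      then show "\<kappa> j \<noteq> \<kappa> k" using jk inj_onD by metis
    qed
  qed
  then have "nc_e d \<pi> = monomial_sum d {\<kappa> \<in> {1..d} \<rightarrow>\<^sub>E {1..}. \<forall>B\<in>\<pi>. inj_on \<kappa> B}"
    by (simp add: nc_e_def)
  also have "\<dots> = word_indicator d (\<lambda>\<kappa>. \<forall>B\<in>\<pi>. inj_on \<kappa> B)"
  proof (rule monomial_sum_eq_word_indicator)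
    fix \<kappa> \<kappa>' :: "nat \<Rightarrow> nat"
    assume "\<And>i. i \<in> {1..d} \<Longrightarrow> \<kappa> i = \<kappa>' i"
    then have "inj_on \<kappa> B = inj_on \<kappa>' B" if "B \<in> \<pi>" for B
      using sub[OF that] by (intro inj_on_cong) auto
    then show "(\<forall>B\<in>\<pi>. inj_on \<kappa> B) = (\<forall>B\<in>\<pi>. inj_on \<kappa>' B)" by simp
  qed
  finally show ?thesis .
qed

section \<open>Constant blocks and Newton's identities\<close>

abbreviation e_span :: "nat \<Rightarrow> nc_series set" where
  "e_span d \<equiv> nc.span (nc_e d ` set_partitions d)"

definition const_on :: "('a \<Rightarrow> 'b) \<Rightarrow> 'a set \<Rightarrow> bool" where
  "const_on f A \<longleftrightarrow> (\<forall>u\<in>A. \<forall>v\<in>A. f u = f v)"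

text \<open>For nonempty \<open>A\<close> inside \<open>C\<close> this says that \<open>A\<close> is
  a whole level set of \<open>f\<close> on \<open>C\<close> and that all other values on
  \<open>C\<close> occur once. It is the noncommutative counterpart of a hook monomial
  m_(k,1,...,1).\<close>

definition isolated_level :: "('a \<Rightarrow> 'b) \<Rightarrow> 'a set \<Rightarrow> 'a set \<Rightarrow> bool" where
  "isolated_level f C A \<longleftrightarrow> const_on f A \<and> inj_on f (C - A) \<and> (\<forall>u\<in>A. \<forall>v\<in>C - A. f u \<noteq> f v)"

text \<open>The common value on \<open>A\<close> is either not taken on \<open>C - A\<close>, or, by
  injectivity there, taken by exactly one \<open>b\<close>, which then joins the level set. This
  refines p_k e_r = m_(k,1,...,1) + m_(k+1,1,...,1).\<close>

lemma const_inj_split: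
  fixes f :: "'a \<Rightarrow> 'b"
  assumes "finite C" "A \<subseteq> C" "A \<noteq> {}"
  shows "(of_bool (const_on f A \<and> inj_on f (C - A)) :: rat)
    = of_bool (isolated_level f C A) + (\<Sum>b\<in>C - A. of_bool (isolated_level f C (insert b A)))"
proof -
  obtain a where a: "a \<in> A" using assms by auto
  show ?thesis
  proof (cases "const_on f A \<and> inj_on f (C - A) \<and> (\<exists>u\<in>A. \<exists>v\<in>C - A. f u = f v)")
    case True
    then obtain b u where "b \<in> C - A" "u \<in> A" "f b = f u" by metis
    moreover have "f u = f a" using True \<open>u \<in> A\<close> a unfolding const_on_def by blast
    ultimately have b: "b \<in> C - A" "f b = f a" by simp_all
    have "isolated_level f C (insert b' A) \<longleftrightarrow> b' = b" if "b' \<in> C - A" for b'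
    proof
      assume "isolated_level f C (insert b' A)"
      then have "b \<notin> C - insert b' A" using a b(2) unfolding isolated_level_def by (metis insertI2)
      then show "b' = b" using b(1) by simp
    next
      assume "b' = b"
      have "f u = f a" if "u \<in> A" for u using True that a unfolding const_on_def by blast
      then have lev: "f u = f a" if "u \<in> insert b A" for u using that b by blast
      have "inj_on f (C - A)" using True by blast
      then have "inj_on f (C - insert b A)" by (rule inj_on_subset) auto
      moreover have "f v \<noteq> f a" if "v \<in> C - insert b A" for v
        using inj_onD[OF \<open>inj_on f (C - A)\<close>, of v b] that b by auto
      ultimately have "isolated_level f C (insert b A)"
        using lev unfolding isolated_level_def const_on_def by fastforce
      then show "isolated_level f C (insert b' A)" using \<open>b' = b\<close> by simp
    qed
    then have "(\<Sum>b'\<in>C - A. of_bool (isolated_level f C (insert b' A)) :: rat)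
        = (\<Sum>b'\<in>C - A. if b' = b then 1 else 0)"
      by (intro sum.cong) auto
    moreover have "\<not> isolated_level f C A" using True unfolding isolated_level_def by blast
    ultimately show ?thesis using True b(1) assms(1) by simp
  next
    case False
    have "\<not> isolated_level f C (insert b A)" if "b \<in> C - A" for b
    proof
      assume iso: "isolated_level f C (insert b A)"
      have fa: "f u = f b" if "u \<in> A" for u using iso that unfolding isolated_level_def const_on_def by blast
      have const: "const_on f A" using iso unfolding isolated_level_def const_on_def by blast
      have sep: "\<forall>v\<in>C - insert b A. f b \<noteq> f v" and inj: "inj_on f (C - insert b A)"
        using iso unfolding isolated_level_def by blast+
      have "inj_on f (C - A)"
      proof (rule inj_onI)
        fix u v assume uv: "u \<in> C - A" "v \<in> C - A" "f u = f v"
        show "u = v"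
        proof (cases "u = b \<or> v = b")
          case True
          then show ?thesis using uv sep by (metis Diff_iff insert_iff)
        next
          case False
          then show ?thesis using inj_onD[OF inj uv(3)] uv by simp
        qed
      qed
      moreover have "(\<exists>u\<in>A. \<exists>v\<in>C - A. f u = f v)" using fa[OF a] a \<open>b \<in> C - A\<close> by blast
      ultimately show False using False const by blast
    qed
    moreover have "isolated_level f C A \<longleftrightarrow> const_on f A \<and> inj_on f (C - A)"
      using False unfolding isolated_level_def by blast
    ultimately show ?thesis by simp
  qed
qed

text \<open>Newton's identities, in the refined form where the power sum is a sum over subsets.\<close>

lemma newton_subsets:
  fixes f :: "'a \<Rightarrow> 'b"
  assumes "finite C" "0 < k"
  shows "of_nat (Suc k) * (\<Sum>A | A \<subseteq> C \<and> card A = Suc k. of_bool (isolated_level f C A) :: rat)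
    = (\<Sum>A | A \<subseteq> C \<and> card A = k. of_bool (const_on f A \<and> inj_on f (C - A)))
      - (\<Sum>A | A \<subseteq> C \<and> card A = k. of_bool (isolated_level f C A))"
proof -
  let ?K = "\<lambda>k. {A. A \<subseteq> C \<and> card A = k}"
  let ?h = "\<lambda>A. of_bool (isolated_level f C A) :: rat"
  have fin: "finite (?K k)" for k using assms by simp
  have finA: "finite A" if "A \<subseteq> C" for A using that assms finite_subset by blast
  have "(\<Sum>A\<in>?K k. of_bool (const_on f A \<and> inj_on f (C - A)) :: rat)
      = (\<Sum>A\<in>?K k. ?h A + (\<Sum>b\<in>C - A. ?h (insert b A)))"
    using assms by (intro sum.cong const_inj_split) auto
  also have "\<dots> = (\<Sum>A\<in>?K k. ?h A) + (\<Sum>p\<in>(SIGMA A:?K k. C - A). ?h (insert (snd p) (fst p)))"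
    using fin assms by (simp add: sum.distrib sum.Sigma case_prod_unfold del: sum_of_bool_eq)
  \<comment> \<open>Double counting: a pair of a k-set and a new element is the same as a (k +
    1)-set with a marked element.\<close>
  also have "(\<Sum>p\<in>(SIGMA A:?K k. C - A). ?h (insert (snd p) (fst p)))
      = (\<Sum>p\<in>(SIGMA A:?K (Suc k). A). ?h (fst p))"
  proof (rule sum.reindex_bij_witness[where i = "\<lambda>p. (fst p - {snd p}, snd p)"
        and j = "\<lambda>p. (insert (snd p) (fst p), snd p)"])
    fix p assume "p \<in> (SIGMA A:?K (Suc k). A)"
    then show "(fst p - {snd p}, snd p) \<in> (SIGMA A:?K k. C - A)"
      using finA by (auto simp: card_Diff_singleton)
  next
    fix p assume "p \<in> (SIGMA A:?K k. C - A)"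
    then show "(insert (snd p) (fst p), snd p) \<in> (SIGMA A:?K (Suc k). A)"
      using finA by (auto simp: card_insert_if)
  qed (auto simp: insert_absorb)
  also have "\<dots> = (\<Sum>A\<in>?K (Suc k). \<Sum>b\<in>A. ?h A)"
    using fin finA by (subst sum.Sigma) (auto simp: case_prod_unfold)
  also have "\<dots> = of_nat (Suc k) * (\<Sum>A\<in>?K (Suc k). ?h A)"
    by (simp add: sum_distrib_left del: sum_of_bool_eq)
  finally show ?thesis by simp
qed

section \<open>The functions $e_\pi$ form a basis\<close>

lemma sum_fun_apply: "(\<Sum>a\<in>S. f a) w = (\<Sum>a\<in>S. f a w)"
  by (induction S rule: infinite_finite_induct) auto

lemma isolated_level_singleton:
  assumes "a \<in> C"
  shows "isolated_level f C {a} \<longleftrightarrow> inj_on f C"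
proof
  assume "isolated_level f C {a}"
  then have "inj_on f (insert a (C - {a}))"
    unfolding isolated_level_def inj_on_insert by auto
  then show "inj_on f C" using assms by (simp add: insert_absorb)
next
  assume inj: "inj_on f C"
  then have "inj_on f (C - {a})" by (rule inj_on_subset) auto
  moreover have "f a \<noteq> f v" if "v \<in> C - {a}" for v
    using inj_onD[OF inj, of a v] that assms by auto
  ultimately show "isolated_level f C {a}"
    unfolding isolated_level_def const_on_def by simp
qed

lemma isolated_level_full: "isolated_level f C C \<longleftrightarrow> const_on f C"
  by (simp add: isolated_level_def)

text \<open>With no constant blocks the indicator is some e_pi. Otherwise one constant block
  \<open>C\<close> is traded, by Newton's identities, for an injective block \<open>C\<close> or for
  a smaller constant block \<open>A\<close> together with the injective block \<open>C - A\<close>.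
  Each trade lowers the total size of the constant blocks.\<close>

lemma const_inj_in_span:
  assumes "partition_on {1..d} (\<sigma> \<union> \<pi>)" "\<sigma> \<inter> \<pi> = {}"
  shows "word_indicator d (\<lambda>\<kappa>. (\<forall>B\<in>\<sigma>. const_on \<kappa> B) \<and> (\<forall>B\<in>\<pi>. inj_on \<kappa> B)) \<in> e_span d"
  using assms
proof (induction "\<Sum>B\<in>\<sigma>. card B" arbitrary: \<sigma> \<pi> rule: less_induct)
  case less
  show ?case
  proof (cases "\<sigma> = {}")
    case True
    then have "partition_on {1..d} \<pi>" using less.prems(1) by simp
    then have "nc_e d \<pi> = word_indicator d (\<lambda>\<kappa>. \<forall>B\<in>\<pi>. inj_on \<kappa> B)" "\<pi> \<in> set_partitions d"
      by (simp_all add: nc_e_eq_word_indicator set_partitions_def)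
    moreover from this(2) have "nc_e d \<pi> \<in> e_span d" by (intro nc.span_base imageI)
    ultimately show ?thesis using True by simp
  next
    case False
    then obtain C where "C \<in> \<sigma>" by auto
    then obtain \<tau> where \<tau>: "\<sigma> = insert C \<tau>" "C \<notin> \<tau>" by (rule Set.set_insert)
    have fin: "finite \<tau>" "finite C" "\<And>B. B \<in> \<tau> \<Longrightarrow> finite B"
    proof -
      have "finite (\<sigma> \<union> \<pi>)" using finite_elements[OF _ less.prems(1)] by simp
      then show "finite \<tau>" using \<tau> by simp
      have "B \<subseteq> {1..d}" if "B \<in> \<sigma>" for B using less.prems(1) that by (auto simp: partition_on_def)
      then show "finite C" "\<And>B. B \<in> \<tau> \<Longrightarrow> finite B"
        using \<tau> by (meson finite_atLeastAtMost finite_subset insertI1 insertI2)+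
    qed
    have part: "partition_on {1..d} (insert C (\<tau> \<union> \<pi>))" using less.prems \<tau> by simp
    have Cnot: "C \<notin> \<tau> \<union> \<pi>" using \<tau> less.prems(2) by auto
    have rest: "partition_on ({1..d} - C) (\<tau> \<union> \<pi>)" and Csub: "C \<subseteq> {1..d}" and Cne: "C \<noteq> {}"
      and dis: "\<And>B. B \<in> \<tau> \<union> \<pi> \<Longrightarrow> C \<inter> B = {}"
    proof -
      have "disjnt C B" if "B \<in> \<tau> \<union> \<pi>" for B
        using pairwiseD[OF partition_onD2[OF part], of C B] Cnot that by blast
      then have "disjnt C (\<Union>(\<tau> \<union> \<pi>))"
        by (simp only: disjnt_Union2) blast
      then have *: "partition_on ({1..d} - C) (\<tau> \<union> \<pi>) \<and> C \<subseteq> {1..d} \<and> C \<noteq> {}"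
        using partition_on_insert[of C "\<tau> \<union> \<pi>" "{1..d}"] part by simp
      then show "partition_on ({1..d} - C) (\<tau> \<union> \<pi>)" "C \<subseteq> {1..d}" "C \<noteq> {}" by simp_all
      show "C \<inter> B = {}" if "B \<in> \<tau> \<union> \<pi>" for B
        using \<open>disjnt C (\<Union>(\<tau> \<union> \<pi>))\<close> that unfolding disjnt_def by blast
    qed
    define R where "R = (\<lambda>\<kappa>::nat \<Rightarrow> nat. (\<forall>B\<in>\<tau>. const_on \<kappa> B) \<and> (\<forall>B\<in>\<pi>. inj_on \<kappa> B))"
    have start: "word_indicator d (\<lambda>\<kappa>. R \<kappa> \<and> inj_on \<kappa> C) \<in> e_span d"
    proof -
      have "(\<Sum>B\<in>\<tau>. card B) < (\<Sum>B\<in>\<sigma>. card B)"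
        using \<tau> fin Cne by (simp add: card_gt_0_iff)
      moreover have "\<tau> \<inter> insert C \<pi> = {}" using \<tau> less.prems(2) by auto
      ultimately have "word_indicator d (\<lambda>\<kappa>. (\<forall>B\<in>\<tau>. const_on \<kappa> B) \<and> (\<forall>B\<in>insert C \<pi>. inj_on \<kappa> B)) \<in> e_span d"
        using part by (intro less.hyps) auto
      then show ?thesis by (simp add: R_def conj_ac)
    qed
    have split: "word_indicator d (\<lambda>\<kappa>. R \<kappa> \<and> const_on \<kappa> A \<and> inj_on \<kappa> (C - A)) \<in> e_span d"
      if A: "A \<subseteq> C" "A \<noteq> {}" "A \<noteq> C" for A
    proof -
      have disA: "A \<inter> B = {}" "(C - A) \<inter> B = {}" if "B \<in> \<tau> \<union> \<pi>" for B
        using dis[OF that] A by auto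
      have notin: "A \<notin> \<tau> \<union> \<pi>" "C - A \<notin> \<tau> \<union> \<pi>" using disA(1)[of A] disA(2)[of "C - A"] A by auto
      have "card A < card C" using A fin by (simp add: psubset_card_mono psubset_eq)
      then have less': "(\<Sum>B\<in>insert A \<tau>. card B) < (\<Sum>B\<in>\<sigma>. card B)"
        using \<tau> fin notin by simp
      have dj: "disjnt (C - A) (\<Union>(\<tau> \<union> \<pi>))" "disjnt A (\<Union>(insert (C - A) (\<tau> \<union> \<pi>)))"
        using dis A unfolding disjnt_def by blast+
      have "{1..d} - A - (C - A) = {1..d} - C" using A by blast
      then have "partition_on {1..d} (insert A (insert (C - A) (\<tau> \<union> \<pi>)))"
        using rest A Csub by (subst partition_on_insert[OF dj(2)], subst partition_on_insert[OF dj(1)]) auto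
      then have "partition_on {1..d} (insert A \<tau> \<union> insert (C - A) \<pi>)"
        by (simp add: Un_commute insert_commute)
      moreover have "insert A \<tau> \<inter> insert (C - A) \<pi> = {}"
        using notin less.prems(2) \<tau> A by auto
      ultimately have "word_indicator d (\<lambda>\<kappa>. (\<forall>B\<in>insert A \<tau>. const_on \<kappa> B)
          \<and> (\<forall>B\<in>insert (C - A) \<pi>. inj_on \<kappa> B)) \<in> e_span d"
        using less' by (intro less.hyps)
      then show ?thesis by (simp add: R_def conj_ac)
    qed
    \<comment> \<open>\<open>N k\<close> is the analogue of p_k e_(|C|-k) and \<open>H k\<close>
      that of the hook monomial with part k. The recursion runs from \<open>H 1\<close>, a multiple
      of the indicator with \<open>C\<close> injective, up to \<open>H (card C)\<close>, the
      indicator with \<open>C\<close> constant.\<close>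
    define H where "H k = (\<Sum>A | A \<subseteq> C \<and> card A = k. word_indicator d (\<lambda>\<kappa>. R \<kappa> \<and> isolated_level \<kappa> C A))" for k
    define N where "N k = (\<Sum>A | A \<subseteq> C \<and> card A = k. word_indicator d (\<lambda>\<kappa>. R \<kappa> \<and> const_on \<kappa> A \<and> inj_on \<kappa> (C - A)))" for k
    have newton: "nc_scale (of_nat (Suc k)) (H (Suc k)) = N k - H k" if "0 < k" for k
    proof
      fix w :: "nat list"
      let ?f = "\<lambda>i. w ! (i - 1)"
      let ?r = "of_bool (length w = d \<and> 0 \<notin> set w \<and> R ?f) :: rat"
      have H: "H k w = ?r * (\<Sum>A | A \<subseteq> C \<and> card A = k. of_bool (isolated_level ?f C A))" for k
        unfolding H_def sum_fun_apply sum_distrib_left word_indicator_def by (intro sum.cong) auto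
      have N: "N k w = ?r * (\<Sum>A | A \<subseteq> C \<and> card A = k. of_bool (const_on ?f A \<and> inj_on ?f (C - A)))"
        unfolding N_def sum_fun_apply sum_distrib_left word_indicator_def by (intro sum.cong) auto
      have "nc_scale (of_nat (Suc k)) (H (Suc k)) w
          = ?r * (of_nat (Suc k) * (\<Sum>A | A \<subseteq> C \<and> card A = Suc k. of_bool (isolated_level ?f C A)))"
        by (simp only: nc_scale_def H mult.left_commute)
      also have "\<dots> = (N k - H k) w"
        unfolding newton_subsets[OF fin(2) that] by (simp only: H N right_diff_distrib fun_diff_def)
      finally show "nc_scale (of_nat (Suc k)) (H (Suc k)) w = (N k - H k) w" .
    qed
    have "k < card C \<Longrightarrow> H (Suc k) \<in> e_span d" for k
    proof (induction k)
      case 0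
      show ?case unfolding H_def
      proof (rule nc.span_sum)
        fix A assume "A \<in> {A. A \<subseteq> C \<and> card A = Suc 0}"
        then obtain a where "A = {a}" "a \<in> C" by (auto simp: card_Suc_eq)
        then show "word_indicator d (\<lambda>\<kappa>. R \<kappa> \<and> isolated_level \<kappa> C A) \<in> e_span d"
          using start by (simp add: isolated_level_singleton)
      qed
    next
      case (Suc k)
      have "N (Suc k) \<in> e_span d"
        unfolding N_def
      proof (rule nc.span_sum)
        fix A assume "A \<in> {A. A \<subseteq> C \<and> card A = Suc k}"
        then show "word_indicator d (\<lambda>\<kappa>. R \<kappa> \<and> const_on \<kappa> A \<and> inj_on \<kappa> (C - A)) \<in> e_span d"
          using Suc.prems by (intro split) auto
      qed
      then have "N (Suc k) - H (Suc k) \<in> e_span d"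
        using Suc by (intro nc.span_diff) auto
      then have "nc_scale (1 / of_nat (Suc (Suc k))) (nc_scale (of_nat (Suc (Suc k))) (H (Suc (Suc k)))) \<in> e_span d"
        unfolding newton[OF zero_less_Suc] by (rule nc.span_scale)
      moreover have "nc_scale (1 / of_nat (Suc (Suc k))) (nc_scale (of_nat (Suc (Suc k))) (H (Suc (Suc k))))
          = H (Suc (Suc k))"
        by (simp add: nc_scale_def fun_eq_iff del: of_nat_Suc)
      ultimately show ?case by simp
    qed
    from this[of "card C - 1"] have "H (card C) \<in> e_span d"
      using Cne fin by (simp add: card_gt_0_iff)
    moreover have "{A. A \<subseteq> C \<and> card A = card C} = {C}"
      using fin(2) card_subset_eq by blast
    ultimately have "word_indicator d (\<lambda>\<kappa>. R \<kappa> \<and> const_on \<kappa> C) \<in> e_span d"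
      by (simp add: H_def isolated_level_full)
    then show ?thesis by (simp add: \<tau>(1) R_def conj_ac)
  qed
qed

section \<open>Equality patterns of words\<close>

definition eqrel :: "nat \<Rightarrow> (nat \<Rightarrow> nat) \<Rightarrow> (nat \<times> nat) set" where
  "eqrel d \<kappa> = {(i, j). i \<in> {1..d} \<and> j \<in> {1..d} \<and> \<kappa> i = \<kappa> j}"

definition equivs :: "nat \<Rightarrow> (nat \<times> nat) set set" where
  "equivs d = {r. equiv {1..d} r}"

lemma equiv_eqrel: "eqrel d \<kappa> \<in> equivs d"
  by (auto simp: eqrel_def equivs_def equiv_def refl_on_def sym_def trans_def)

lemma finite_equivs: "finite (equivs d)"
proof (rule finite_subset)
  show "equivs d \<subseteq> Pow ({1..d} \<times> {1..d})"
    by (auto simp: equivs_def dest: equiv_type)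
qed simp

lemma word_indicator_expand:
  "word_indicator d (\<lambda>\<kappa>. P (eqrel d \<kappa>)) = (\<Sum>r\<in>{r \<in> equivs d. P r}. word_indicator d (\<lambda>\<kappa>. eqrel d \<kappa> = r))"
proof
  fix w
  let ?r = "eqrel d (\<lambda>i. w ! (i - 1))"
  have "(\<Sum>r\<in>{r \<in> equivs d. P r}. word_indicator d (\<lambda>\<kappa>. eqrel d \<kappa> = r)) w
      = (\<Sum>r\<in>{r \<in> equivs d. P r}. if r = ?r then of_bool (length w = d \<and> 0 \<notin> set w) else 0)"
    unfolding sum_fun_apply word_indicator_def by (intro sum.cong) auto
  also have "\<dots> = word_indicator d (\<lambda>\<kappa>. P (eqrel d \<kappa>)) w"
    using finite_equivs equiv_eqrel by (auto simp: sum.delta' word_indicator_def)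
  finally show "word_indicator d (\<lambda>\<kappa>. P (eqrel d \<kappa>)) w
      = (\<Sum>r\<in>{r \<in> equivs d. P r}. word_indicator d (\<lambda>\<kappa>. eqrel d \<kappa> = r)) w" by simp
qed

text \<open>The indicator of \<open>r\<close> being contained in the pattern is a noncommutative
  power sum: constant on every class of \<open>r\<close>. It is also the sum of the exact indicators
  over all patterns containing \<open>r\<close>, so solving for the exact one, starting from the
  coarsest pattern, stays in the span.\<close>

lemma eqrel_indicator_in_span:
  assumes "r \<in> equivs d"
  shows "word_indicator d (\<lambda>\<kappa>. eqrel d \<kappa> = r) \<in> e_span d"
  using assms
proof (induction "card ({1..d} \<times> {1..d}) - card r" arbitrary: r rule: less_induct)
  case less
  have eq: "equiv {1..d} r" using less.prems by (simp add: equivs_def)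
  have sub: "s \<subseteq> {1..d} \<times> {1..d}" if "s \<in> equivs d" for s
    using that by (simp add: equivs_def equiv_type)
  have "r \<subseteq> eqrel d \<kappa> \<longleftrightarrow> (\<forall>B\<in>{1..d} // r. const_on \<kappa> B)" for \<kappa>
  proof
    assume r: "r \<subseteq> eqrel d \<kappa>"
    show "\<forall>B\<in>{1..d} // r. const_on \<kappa> B"
      unfolding const_on_def
    proof (intro ballI)
      fix B u v assume "B \<in> {1..d} // r" "u \<in> B" "v \<in> B"
      then have "(u, v) \<in> r" using eq by (meson quotient_eq_iff)
      then show "\<kappa> u = \<kappa> v" using r by (auto simp: eqrel_def)
    qed
  next
    assume c: "\<forall>B\<in>{1..d} // r. const_on \<kappa> B"
    show "r \<subseteq> eqrel d \<kappa>"
    proof (rule subrelI)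
      fix i j assume ij: "(i, j) \<in> r"
      then have "i \<in> {1..d}" "j \<in> {1..d}" using sub[OF less.prems] by auto
      moreover have "i \<in> r `` {i}" "j \<in> r `` {i}" "r `` {i} \<in> {1..d} // r"
        using ij equiv_class_self[OF eq \<open>i \<in> {1..d}\<close>] \<open>i \<in> {1..d}\<close> by (auto intro: quotientI)
      then have "\<kappa> i = \<kappa> j" using c unfolding const_on_def by blast
      ultimately show "(i, j) \<in> eqrel d \<kappa>" by (simp add: eqrel_def)
    qed
  qed
  moreover have "word_indicator d (\<lambda>\<kappa>. (\<forall>B\<in>{1..d} // r. const_on \<kappa> B) \<and> (\<forall>B\<in>{}. inj_on \<kappa> B)) \<in> e_span d"
    using partition_on_quotient[OF eq] by (intro const_inj_in_span) auto
  ultimately have p: "word_indicator d (\<lambda>\<kappa>. r \<subseteq> eqrel d \<kappa>) \<in> e_span d"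
    by simp
  have "word_indicator d (\<lambda>\<kappa>. r \<subseteq> eqrel d \<kappa>)
      = (\<Sum>s\<in>{s \<in> equivs d. r \<subseteq> s}. word_indicator d (\<lambda>\<kappa>. eqrel d \<kappa> = s))"
    by (rule word_indicator_expand)
  also have "{s \<in> equivs d. r \<subseteq> s} = insert r {s \<in> equivs d. r \<subset> s}"
    using less.prems by auto
  also have "(\<Sum>s\<in>\<dots>. word_indicator d (\<lambda>\<kappa>. eqrel d \<kappa> = s)) = word_indicator d (\<lambda>\<kappa>. eqrel d \<kappa> = r)
      + (\<Sum>s\<in>{s \<in> equivs d. r \<subset> s}. word_indicator d (\<lambda>\<kappa>. eqrel d \<kappa> = s))"
    using finite_equivs[of d] by (intro sum.insert) auto
  finally have "word_indicator d (\<lambda>\<kappa>. eqrel d \<kappa> = r) = word_indicator d (\<lambda>\<kappa>. r \<subseteq> eqrel d \<kappa>)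
      - (\<Sum>s\<in>{s \<in> equivs d. r \<subset> s}. word_indicator d (\<lambda>\<kappa>. eqrel d \<kappa> = s))"
    by (simp only: add_diff_cancel_right')
  also have "\<dots> \<in> e_span d"
  proof (intro nc.span_diff p nc.span_sum)
    fix s assume s: "s \<in> {s \<in> equivs d. r \<subset> s}"
    then have "finite s" "s \<subseteq> {1..d} \<times> {1..d}" using sub finite_subset by blast+
    then have "card r < card s" "card s \<le> card ({1..d} \<times> {1..d})"
      using s by (simp add: psubset_card_mono) (rule card_mono, simp, fact)
    then show "word_indicator d (\<lambda>\<kappa>. eqrel d \<kappa> = s) \<in> e_span d"
      using s by (intro less.hyps) auto
  qed
  finally show ?case .
qed

lemma word_indicator_in_span:
  "word_indicator d (\<lambda>\<kappa>. P (eqrel d \<kappa>)) \<in> e_span d"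
  unfolding word_indicator_expand
  by (intro nc.span_sum eqrel_indicator_in_span) simp

text \<open>Naming each class by its least element keeps the letters within {1..d}. This is what
  lets finitely many colours detect every pattern.\<close>

definition canonical_word :: "(nat \<times> nat) set \<Rightarrow> nat \<Rightarrow> nat" where
  "canonical_word r i = Min (r `` {i})"

lemma canonical_word:
  assumes "r \<in> equivs d"
  shows "i \<in> {1..d} \<Longrightarrow> canonical_word r i \<in> {1..d}" "eqrel d (canonical_word r) = r"
proof -
  have eq: "equiv {1..d} r" using assms by (simp add: equivs_def)
  have sub: "r \<subseteq> {1..d} \<times> {1..d}" using eq by (rule equiv_type)
  have m: "canonical_word r i \<in> r `` {i}" if "i \<in> {1..d}" for i
  proof -
    have "i \<in> r `` {i}" using eq that by (rule equiv_class_self)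
    moreover have "r `` {i} \<subseteq> {1..d}" using sub by blast
    then have "finite (r `` {i})" by (rule finite_subset) simp
    ultimately show ?thesis unfolding canonical_word_def by (intro Min_in) blast+
  qed
  then show "canonical_word r i \<in> {1..d}" if "i \<in> {1..d}" using sub that by blast
  show "eqrel d (canonical_word r) = r"
  proof (intro set_eqI iffI; clarify)
    fix i j assume "(i, j) \<in> eqrel d (canonical_word r)"
    then have ij: "i \<in> {1..d}" "j \<in> {1..d}" "canonical_word r i = canonical_word r j"
      by (auto simp: eqrel_def)
    then have "(i, canonical_word r i) \<in> r" "(j, canonical_word r i) \<in> r"
      using m[of i] m[of j] by auto
    then show "(i, j) \<in> r" using eq unfolding equiv_def by (meson symE transE)
  next
    fix i j assume ij: "(i, j) \<in> r"
    then have "r `` {i} = r `` {j}" using eq by (rule equiv_class_eq[rotated])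
    then show "(i, j) \<in> eqrel d (canonical_word r)"
      using ij sub by (auto simp: eqrel_def canonical_word_def)
  qed
qed

lemma word_indicator_canonical:
  assumes "r \<in> equivs d"
  shows "word_indicator d (\<lambda>\<kappa>. P (eqrel d \<kappa>)) (map (canonical_word r) [1..<Suc d]) = of_bool (P r)"
proof -
  let ?w = "map (canonical_word r) [1..<Suc d]"
  have "eqrel d (\<lambda>i. ?w ! (i - 1)) = eqrel d (canonical_word r)"
    by (auto simp: eqrel_def simp del: upt_Suc)
  moreover have "0 \<notin> set ?w"
  proof
    assume "0 \<in> set ?w"
    then obtain i where "i \<in> {1..d}" "canonical_word r i = 0"
      by (auto simp: less_Suc_eq_le simp del: upt_Suc)
    then show False using canonical_word(1)[OF assms, of i] by simp
  qed
  ultimately show ?thesis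
    using canonical_word(2)[OF assms] by (simp add: word_indicator_def del: upt_Suc)
qed

text \<open>A dimension count. The exact pattern indicators are independent, since evaluation at
  canonical words separates them, and they lie in the span of the e_pi. There are at most as many
  set partitions as patterns, so a maximal independent set of e_pi must contain them all and no two
  e_pi coincide.\<close>

lemma independent_nc_e: "nc.independent (nc_e d ` set_partitions d)"
  and inj_nc_e: "inj_on (nc_e d) (set_partitions d)"
proof -
  let ?m = "\<lambda>r. word_indicator d (\<lambda>\<kappa>. eqrel d \<kappa> = r)"
  let ?E = "nc_e d ` set_partitions d"
  have eval: "?m s (map (canonical_word r) [1..<Suc d]) = of_bool (r = s)" if "r \<in> equivs d" for r s
    using word_indicator_canonical[OF that, of "\<lambda>t. t = s"] by simp
  have inj_m: "inj_on ?m (equivs d)"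
  proof (rule inj_onI)
    fix r s assume "r \<in> equivs d" "s \<in> equivs d" "?m r = ?m s"
    then show "r = s" using eval[of r r] eval[of r s] by (simp del: upt_Suc split: if_splits)
  qed
  have ind_m: "nc.independent (?m ` equivs d)"
  proof (rule nc.independent_if_scalars_zero)
    show "finite (?m ` equivs d)" using finite_equivs by simp
    fix u v assume 0: "(\<Sum>v\<in>?m ` equivs d. nc_scale (u v) v) = 0" and "v \<in> ?m ` equivs d"
    then obtain r where r: "r \<in> equivs d" "v = ?m r" by auto
    have "0 = (\<Sum>v\<in>?m ` equivs d. nc_scale (u v) v) (map (canonical_word r) [1..<Suc d])"
      unfolding 0 by simp
    also have "\<dots> = (\<Sum>s\<in>equivs d. u (?m s) * ?m s (map (canonical_word r) [1..<Suc d]))"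
      unfolding sum_fun_apply nc_scale_def by (rule sum.reindex_cong[OF inj_m]) auto
    also have "\<dots> = (\<Sum>s\<in>equivs d. if s = r then u (?m r) else 0)"
      using eval[OF r(1)] by (intro sum.cong) auto
    also have "\<dots> = u (?m r)" using finite_equivs r by simp
    finally show "u v = 0" using r by simp
  qed
  have finP: "finite (set_partitions d)"
    unfolding set_partitions_def by (rule finitely_many_partition_on) simp
  have "set_partitions d = (\<lambda>r. {1..d} // r) ` equivs d"
    by (auto simp: set_partitions_def equivs_def partition_on_alt)
  then have "card (set_partitions d) \<le> card (equivs d)"
    using card_image_le[OF finite_equivs] by metis
  moreover obtain B where B: "B \<subseteq> ?E" "nc.independent B" "?E \<subseteq> nc.span B"
    by (rule nc.maximal_independent_subset)
  have finB: "finite B" using B(1) finP finite_subset by blast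
  have "?m ` equivs d \<subseteq> nc.span B"
    using eqrel_indicator_in_span nc.span_minimal[OF B(3) nc.subspace_span] by blast
  from nc.independent_span_bound[OF finB ind_m this] have "card (equivs d) \<le> card B"
    using card_image[OF inj_m] by simp
  moreover have "card B \<le> card ?E" using B(1) finP by (intro card_mono) auto
  moreover have "card ?E \<le> card (set_partitions d)" using finP by (rule card_image_le)
  ultimately have "card B = card ?E" "card ?E = card (set_partitions d)" by simp_all
  then show "nc.independent ?E" "inj_on (nc_e d) (set_partitions d)"
    using B finP card_subset_eq[of ?E B] by (auto intro: eq_card_imp_inj_on)
qed

lemma finite_set_partitions: "finite (set_partitions d)"
  unfolding set_partitions_def by (rule finitely_many_partition_on) simp

lemma inj_on_blocks_eqrel:
  fixes \<kappa> :: "nat \<Rightarrow> nat"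
  assumes "\<pi> \<in> set_partitions d"
  shows "(\<forall>B\<in>\<pi>. inj_on \<kappa> B) \<longleftrightarrow> (\<forall>B\<in>\<pi>. \<forall>i\<in>B. \<forall>j\<in>B. (i, j) \<in> eqrel d \<kappa> \<longrightarrow> i = j)"
proof -
  have "B \<subseteq> {1..d}" if "B \<in> \<pi>" for B
    using assms that by (auto simp: set_partitions_def partition_on_def)
  then show ?thesis unfolding inj_on_def eqrel_def by blast
qed

text \<open>Whether a colouring is injective on the blocks depends only on its equality pattern, so
  testing colourings with values in {1..d} tests all words.\<close>

lemma nc_e_coeffs_zero:
  assumes zero: "\<And>\<kappa>. (\<And>i. i \<in> {1..d} \<Longrightarrow> \<kappa> i \<in> {1..d}) \<Longrightarrow>
      (\<Sum>\<pi>\<in>set_partitions d. c \<pi> * of_bool (\<forall>B\<in>\<pi>. inj_on \<kappa> B)) = (0 :: rat)"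
    and \<pi>: "\<pi> \<in> set_partitions d"
  shows "c \<pi> = 0"
proof -
  let ?P = "set_partitions d"
  have "(\<Sum>\<pi>\<in>?P. nc_scale (c \<pi>) (nc_e d \<pi>)) = 0"
  proof
    fix w :: "nat list"
    let ?f = "\<lambda>i. w ! (i - 1)"
    let ?k = "canonical_word (eqrel d ?f)"
    have k: "eqrel d ?k = eqrel d ?f" "\<And>i. i \<in> {1..d} \<Longrightarrow> ?k i \<in> {1..d}"
      using canonical_word[OF equiv_eqrel[of d ?f]] by auto
    have "(\<Sum>\<pi>\<in>?P. nc_scale (c \<pi>) (nc_e d \<pi>)) w
        = (\<Sum>\<pi>\<in>?P. c \<pi> * (of_bool (length w = d \<and> 0 \<notin> set w) * of_bool (\<forall>B\<in>\<pi>. inj_on ?f B)))"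
      unfolding sum_fun_apply nc_scale_def
      by (intro sum.cong) (auto simp: nc_e_eq_word_indicator set_partitions_def word_indicator_def)
    also have "\<dots> = of_bool (length w = d \<and> 0 \<notin> set w) * (\<Sum>\<pi>\<in>?P. c \<pi> * of_bool (\<forall>B\<in>\<pi>. inj_on ?k B))"
      unfolding sum_distrib_left
      by (intro sum.cong refl) (simp only: inj_on_blocks_eqrel k(1) mult.left_commute)
    also have "\<dots> = 0" using zero[of ?k] k(2) by simp
    finally show "(\<Sum>\<pi>\<in>?P. nc_scale (c \<pi>) (nc_e d \<pi>)) w = 0 w" by simp
  qed
  \<comment> \<open>\<open>nc.independentD\<close> wants coefficients indexed by vectors;
    injectivity of \<open>nc_e\<close> recovers the partition.\<close>
  then have "(\<Sum>v\<in>nc_e d ` ?P. nc_scale (c (inv_into ?P (nc_e d) v)) v) = 0"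
    by (subst sum.reindex[OF inj_nc_e]) (simp add: inv_into_f_f[OF inj_nc_e] cong: sum.cong)
  from nc.independentD[OF independent_nc_e _ subset_refl this, of "nc_e d \<pi>"]
  show ?thesis
    using \<pi> finite_set_partitions by (simp add: inv_into_f_f[OF inj_nc_e])
qed

section \<open>Commuting all letters but the last\<close>

text \<open>The last letter is fixed to \<open>j\<close> and carries no weight.\<close>

definition phi :: "nat set \<Rightarrow> nat \<Rightarrow> nc_series \<Rightarrow> (nat \<Rightarrow> rat) \<Rightarrow> nat \<Rightarrow> rat" where
  "phi C d f x j = wsum C x {1..<d} (\<lambda>\<kappa>. f (map (\<kappa>(d := j)) [1..<Suc d]))"

definition e_term :: "nat set \<Rightarrow> (nat \<Rightarrow> rat) \<Rightarrow> nat \<Rightarrow> nat multiset \<times> nat \<Rightarrow> rat" where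
  "e_term C x j t = (\<Prod>c\<in>#fst t. ehat x c C) * ehat x (snd t - 1) (C - {j})"

lemma phi_sum: "phi C d (\<Sum>s\<in>S. nc_scale (c s) (f s)) x j = (\<Sum>s\<in>S. c s * phi C d (f s) x j)"
  unfolding phi_def sum_fun_apply nc_scale_def wsum_sum wsum_cmult ..

lemma phi_word_indicator:
  assumes "0 \<notin> C" "j \<in> C" "1 \<le> d"
    and dep: "\<And>\<kappa> \<kappa>'. (\<And>i. i \<in> {1..d} \<Longrightarrow> \<kappa> i = \<kappa>' i) \<Longrightarrow> P \<kappa> = P \<kappa>'"
  shows "phi C d (word_indicator d P) x j = wsum C x {1..<d} (\<lambda>\<kappa>. of_bool (P (\<kappa>(d := j))))"
  unfolding phi_def
proof (rule wsum_cong)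
  fix \<kappa> assume \<kappa>: "\<kappa> \<in> {1..<d} \<rightarrow>\<^sub>E C"
  let ?k = "\<kappa>(d := j)"
  let ?w = "map ?k [1..<Suc d]"
  have "?w ! (i - 1) = ?k i" if "i \<in> {1..d}" for i
  proof -
    have "i - 1 < length [1..<Suc d]" using that by (auto simp del: upt_Suc)
    then have "?w ! (i - 1) = ?k ([1..<Suc d] ! (i - 1))" by (rule nth_map)
    also have "[1..<Suc d] ! (i - 1) = i" using that by (subst nth_upt) auto
    finally show ?thesis .
  qed
  then have "P (\<lambda>i. ?w ! (i - 1)) = P ?k" by (rule dep)
  moreover have "0 \<notin> set ?w"
  proof
    assume "0 \<in> set ?w"
    then obtain i where i: "i \<in> set [1..<Suc d]" "0 = ?k i" unfolding set_map by (elim imageE)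
    then have "i \<in> {1..d}" by (auto simp del: upt_Suc)
    moreover have "?k i \<in> C" using \<kappa> assms(2) \<open>i \<in> {1..d}\<close> by (cases "i = d") auto
    ultimately show False using assms(1) i(2) by metis
  qed
  ultimately show "word_indicator d P ?w = of_bool (P ?k)"
    by (simp add: word_indicator_def del: upt_Suc)
qed

lemma inj_on_blocks_cong:
  fixes \<kappa> \<kappa>' :: "nat \<Rightarrow> nat"
  assumes "\<And>i. i \<in> \<Union>\<pi> \<Longrightarrow> \<kappa> i = \<kappa>' i"
  shows "(\<forall>B\<in>\<pi>. inj_on \<kappa> B) = (\<forall>B\<in>\<pi>. inj_on \<kappa>' B)"
proof -
  have "inj_on \<kappa> B = inj_on \<kappa>' B" if "B \<in> \<pi>" for B
    using assms that by (intro inj_on_cong) auto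
  then show ?thesis by simp
qed

text \<open>Blocks are coloured independently. In the block of \<open>d\<close> the colour at
  \<open>d\<close> is fixed to \<open>j\<close>, so its other vertices receive distinct colours from
  \<open>C - {j}\<close>.\<close>

lemma phi_nc_e:
  assumes \<pi>: "partition_on {1..d} \<pi>" and C: "0 \<notin> C" "finite C" "j \<in> C" and d: "1 \<le> d"
  shows "phi C d (nc_e d \<pi>) x j = e_term C x j (partition_type d \<pi>)"
proof -
  define D where "D = block \<pi> d"
  define \<sigma> where "\<sigma> = \<pi> - {D}"
  have D: "D \<in> \<pi>" "d \<in> D" using partition_block[OF \<pi>, of d] d by (simp_all add: D_def)
  have ins: "\<pi> = insert D \<sigma>" using D by (auto simp: \<sigma>_def)
  have fin: "finite \<pi>" using finite_elements[OF _ \<pi>] by simp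
  have sub: "B \<subseteq> {1..d}" if "B \<in> \<pi>" for B using partition_onD1[OF \<pi>] that by auto
  have finB: "finite B" if "B \<in> \<pi>" for B using sub[OF that] finite_subset by blast
  have dis: "D \<inter> \<Union>\<sigma> = {}"
  proof -
    have "D \<inter> B = {}" if "B \<in> \<sigma>" for B
      using partition_onD2[OF \<pi>] D that by (auto simp: disjoint_def \<sigma>_def)
    then show ?thesis by blast
  qed
  have all: "{1..<d} = \<Union>\<sigma> \<union> (D - {d})"
  proof -
    have "{1..<d} = {1..d} - {d}" by auto
    also have "\<dots> = \<Union>\<sigma> \<union> (D - {d})"
      using partition_onD1[OF \<pi>] dis D(2) unfolding ins by auto
    finally show ?thesis .
  qed
  have "phi C d (nc_e d \<pi>) x j = wsum C x {1..<d} (\<lambda>\<kappa>. of_bool (\<forall>B\<in>\<pi>. inj_on (\<kappa>(d := j)) B))"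
    unfolding nc_e_eq_word_indicator[OF \<pi>]
    using C d partition_onD1[OF \<pi>] by (intro phi_word_indicator inj_on_blocks_cong) auto
  also have "\<dots> = wsum C x {1..<d} (\<lambda>\<kappa>. of_bool (\<forall>B\<in>\<sigma>. inj_on \<kappa> B)
      * of_bool (inj_on \<kappa> (D - {d}) \<and> \<kappa> ` (D - {d}) \<subseteq> C - {j}))"
  proof (rule wsum_cong)
    fix \<kappa> assume \<kappa>: "\<kappa> \<in> {1..<d} \<rightarrow>\<^sub>E C"
    have "d \<notin> \<Union>\<sigma>" using dis D(2) by blast
    then have "(\<forall>B\<in>\<sigma>. inj_on (\<kappa>(d := j)) B) = (\<forall>B\<in>\<sigma>. inj_on \<kappa> B)"
      by (intro inj_on_blocks_cong) auto
    moreover have "inj_on (\<kappa>(d := j)) D \<longleftrightarrow> inj_on \<kappa> (D - {d}) \<and> \<kappa> ` (D - {d}) \<subseteq> C - {j}"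
    proof -
      have "\<kappa> v \<in> C" if "v \<in> D - {d}" for v
        using \<kappa> all that by auto
      moreover have "D = insert d (D - {d})" using D(2) by auto
      then have "inj_on (\<kappa>(d := j)) D \<longleftrightarrow> inj_on \<kappa> (D - {d}) \<and> j \<notin> \<kappa> ` (D - {d})"
        using inj_on_insert[of "\<kappa>(d := j)" d "D - {d}"] by (simp add: inj_on_fun_updI inj_on_def)
      ultimately show ?thesis by blast
    qed
    ultimately have "(\<forall>B\<in>\<pi>. inj_on (\<kappa>(d := j)) B) \<longleftrightarrow> (\<forall>B\<in>\<sigma>. inj_on \<kappa> B)
      \<and> (inj_on \<kappa> (D - {d}) \<and> \<kappa> ` (D - {d}) \<subseteq> C - {j})"
      unfolding ins by blast
    then show "of_bool (\<forall>B\<in>\<pi>. inj_on (\<kappa>(d := j)) B) = (of_bool (\<forall>B\<in>\<sigma>. inj_on \<kappa> B)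
      * of_bool (inj_on \<kappa> (D - {d}) \<and> \<kappa> ` (D - {d}) \<subseteq> C - {j}) :: rat)"
      by (simp only: of_bool_conj)
  qed
  also have "\<dots> = wsum C x (\<Union>\<sigma>) (\<lambda>\<kappa>. of_bool (\<forall>B\<in>\<sigma>. inj_on \<kappa> B))
      * wsum C x (D - {d}) (\<lambda>\<kappa>. of_bool (inj_on \<kappa> (D - {d}) \<and> \<kappa> ` (D - {d}) \<subseteq> C - {j}))"
    unfolding all
  proof (rule wsum_Un)
    show "finite (\<Union>\<sigma>)" "finite (D - {d})" using fin finB D(1) by (auto simp: \<sigma>_def)
    show "\<Union>\<sigma> \<inter> (D - {d}) = {}" using dis by auto
    show "of_bool (\<forall>B\<in>\<sigma>. inj_on \<kappa> B) = (of_bool (\<forall>B\<in>\<sigma>. inj_on \<kappa>' B) :: rat)"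
      if "\<And>v. v \<in> \<Union>\<sigma> \<Longrightarrow> \<kappa> v = \<kappa>' v" for \<kappa> \<kappa>' :: "nat \<Rightarrow> nat"
      using inj_on_blocks_cong[OF that] by simp
    show "of_bool (inj_on \<kappa> (D - {d}) \<and> \<kappa> ` (D - {d}) \<subseteq> C - {j})
        = (of_bool (inj_on \<kappa>' (D - {d}) \<and> \<kappa>' ` (D - {d}) \<subseteq> C - {j}) :: rat)"
      if "\<And>v. v \<in> D - {d} \<Longrightarrow> \<kappa> v = \<kappa>' v" for \<kappa> \<kappa>' :: "nat \<Rightarrow> nat"
      using inj_on_cong[of "D - {d}" \<kappa> \<kappa>'] image_cong[of "D - {d}" "D - {d}" \<kappa> \<kappa>'] that by simp
  qed
  also have "wsum C x (\<Union>\<sigma>) (\<lambda>\<kappa>. of_bool (\<forall>B\<in>\<sigma>. inj_on \<kappa> B)) = (\<Prod>B\<in>\<sigma>. ehat x (card B) C)"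
    using fin finB C partition_onD2[OF \<pi>]
    by (intro wsum_inj_blocks) (auto simp: \<sigma>_def intro: pairwise_subset)
  also have "wsum C x (D - {d}) (\<lambda>\<kappa>. of_bool (inj_on \<kappa> (D - {d}) \<and> \<kappa> ` (D - {d}) \<subseteq> C - {j}))
      = ehat x (card (D - {d})) (C - {j})"
    using finB D C by (intro wsum_inj) auto
  also have "card (D - {d}) = card D - 1" using D(2) by simp
  also have "(\<Prod>B\<in>\<sigma>. ehat x (card B) C) * ehat x (card D - 1) (C - {j})
      = e_term C x j (partition_type d \<pi>)"
    by (simp add: e_term_def partition_type_def D_def \<sigma>_def multiset.map_comp prod_unfold_prod_mset comp_def)
  finally show ?thesis .
qed

text \<open>The weighted sums are known as values at rational points, not as formal polynomials. One
  variable at a time is regarded as the indeterminate of a univariate polynomial, which is zero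
  because it vanishes on the infinite field of rationals.\<close>

lemma monomials_independent:
  assumes "finite C" "finite S" "\<And>m. m \<in> S \<Longrightarrow> set_mset m \<subseteq> C"
    and "\<And>x. (\<Sum>m\<in>S. a m * (\<Prod>i\<in>#m. x i)) = (0 :: rat)" and "m \<in> S"
  shows "a m = 0"
  using assms
proof (induction C arbitrary: S a m)
  case empty
  then have "S = {{#}}" "m = {#}" by auto
  then show ?case using empty.prems(3) by simp
next
  case (insert c C)
  let ?rest = "filter_mset (\<lambda>i. i \<noteq> c)"
  define k where "k = count m c"
  define S' where "S' = {m \<in> S. count m c = k}"
  have dec: "m' = ?rest m' + replicate_mset (count m' c) c" for m'
    by (rule multiset_eqI) simp
  have coeff: "(\<Sum>m\<in>S'. a m * (\<Prod>i\<in>#?rest m. x i)) = 0" for x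
  proof -
    define p where "p = (\<Sum>m\<in>S. monom (a m * (\<Prod>i\<in>#?rest m. x i)) (count m c))"
    have "poly p y = 0" for y
    proof -
      have "poly p y = (\<Sum>m\<in>S. a m * (\<Prod>i\<in>#m. (x(c := y)) i))"
        unfolding p_def poly_sum poly_monom
      proof (rule sum.cong[OF refl])
        fix m' assume "m' \<in> S"
        have "(\<Prod>i\<in>#m'. (x(c := y)) i)
            = (\<Prod>i\<in>#?rest m'. (x(c := y)) i) * (\<Prod>i\<in>#replicate_mset (count m' c) c. (x(c := y)) i)"
          by (subst dec) simp
        also have "image_mset (x(c := y)) (?rest m') = image_mset x (?rest m')"
          by (rule image_mset_cong) auto
        finally show "a m' * (\<Prod>i\<in>#?rest m'. x i) * y ^ count m' c = a m' * (\<Prod>i\<in>#m'. (x(c := y)) i)"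
          by simp
      qed
      then show ?thesis using insert.prems(3)[of "x(c := y)"] by simp
    qed
    then have "p = 0" using poly_all_0_iff_0 by blast
    then have "0 = coeff p k" by simp
    also have "\<dots> = (\<Sum>m\<in>S. if count m c = k then a m * (\<Prod>i\<in>#?rest m. x i) else 0)"
      by (simp add: p_def coeff_sum)
    also have "\<dots> = (\<Sum>m\<in>S'. a m * (\<Prod>i\<in>#?rest m. x i))"
      unfolding S'_def using insert.prems(1) by (intro sum.inter_filter[symmetric])
    finally show ?thesis by simp
  qed
  \<comment> \<open>On \<open>S'\<close> the exponent of \<open>c\<close> is always
    \<open>k\<close>, so deleting \<open>c\<close> is undone by \<open>?ext\<close> and only the
    variables from the smaller set remain.\<close>
  let ?ext = "\<lambda>m. m + replicate_mset k c"
  have ext: "?ext (?rest m') = m'" if "m' \<in> S'" for m'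
    using dec[of m'] that by (simp add: S'_def)
  have inj: "inj_on ?rest S'" by (rule inj_on_inverseI[where g = ?ext]) (rule ext)
  have "a (?ext (?rest m)) = 0"
  proof (rule insert.IH[where S = "?rest ` S'" and a = "\<lambda>m. a (?ext m)" and m = "?rest m"])
    show "finite (?rest ` S')" using insert.prems by (simp add: S'_def)
    show "set_mset m' \<subseteq> C" if "m' \<in> ?rest ` S'" for m'
    proof -
      from that obtain m'' where "m' = ?rest m''" "m'' \<in> S" by (auto simp: S'_def)
      then show ?thesis using insert.prems(2)[of m''] by auto
    qed
    show "(\<Sum>m\<in>?rest ` S'. a (?ext m) * (\<Prod>i\<in>#m. x i)) = 0" for x
      using coeff[of x] by (simp add: sum.reindex[OF inj] ext)
    show "?rest m \<in> ?rest ` S'" using insert.prems(4) by (simp add: S'_def k_def)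
  qed
  then show ?case using dec[of m] by (simp add: k_def)
qed

lemma wsum_content_sums_zero:
  assumes "finite A" "finite C" "\<And>x. wsum C x A F = 0" "\<kappa>\<^sub>0 \<in> A \<rightarrow>\<^sub>E C"
  shows "(\<Sum>\<kappa> | \<kappa> \<in> A \<rightarrow>\<^sub>E C \<and> image_mset \<kappa> (mset_set A) = image_mset \<kappa>\<^sub>0 (mset_set A). F \<kappa>) = 0"
proof -
  let ?X = "A \<rightarrow>\<^sub>E C" and ?g = "\<lambda>\<kappa>. image_mset \<kappa> (mset_set A)"
  have fin: "finite ?X" using assms by (intro finite_PiE) auto
  have "(\<Sum>m\<in>?g ` ?X. (\<Sum>\<kappa> | \<kappa> \<in> ?X \<and> ?g \<kappa> = m. F \<kappa>) * (\<Prod>i\<in>#m. x i)) = 0" for x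
  proof -
    have "wsum C x A F = (\<Sum>m\<in>?g ` ?X. \<Sum>\<kappa> | \<kappa> \<in> ?X \<and> ?g \<kappa> = m. F \<kappa> * (\<Prod>v\<in>A. x (\<kappa> v)))"
      unfolding wsum_def by (rule sum.image_gen[OF fin])
    also have "\<dots> = (\<Sum>m\<in>?g ` ?X. (\<Sum>\<kappa> | \<kappa> \<in> ?X \<and> ?g \<kappa> = m. F \<kappa>) * (\<Prod>i\<in>#m. x i))"
      unfolding sum_distrib_right
      by (intro sum.cong) (auto simp: prod_unfold_prod_mset multiset.map_comp comp_def)
    finally show ?thesis using assms(3) by simp
  qed
  moreover have "set_mset m \<subseteq> C" if "m \<in> ?g ` ?X" for m
    using that assms(1) by (auto simp: PiE_iff)
  ultimately show ?thesis
    using fin assms(2,4)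
    by (intro monomials_independent[where a = "\<lambda>m. \<Sum>\<kappa> | \<kappa> \<in> ?X \<and> ?g \<kappa> = m. F \<kappa>" and S = "?g ` ?X"]) blast+
qed

text \<open>Two colourings with the same multiset of colours differ by a permutation of
  \<open>A\<close>, so \<open>F\<close> is constant on such a class. The vanishing coefficient of
  the class is then its size times that value.\<close>

lemma symmetric_wsum_zero:
  assumes "finite A" "finite C" "\<And>x. wsum C x A F = 0" "\<kappa> \<in> A \<rightarrow>\<^sub>E C"
    and inv: "\<And>\<kappa> \<tau>. \<kappa> \<in> A \<rightarrow>\<^sub>E C \<Longrightarrow> \<tau> permutes A \<Longrightarrow> F (\<kappa> \<circ> \<tau>) = F \<kappa>"
  shows "F \<kappa> = 0"
proof -
  let ?W = "{\<kappa>'. \<kappa>' \<in> A \<rightarrow>\<^sub>E C \<and> image_mset \<kappa>' (mset_set A) = image_mset \<kappa> (mset_set A)}"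
  have "F \<kappa>' = F \<kappa>" if "\<kappa>' \<in> ?W" for \<kappa>'
  proof -
    from that obtain \<tau> where \<tau>: "\<tau> permutes A" "\<forall>v\<in>A. \<kappa>' v = \<kappa> (\<tau> v)"
      using image_mset_eq_implies_permutes[OF assms(1), of \<kappa>' \<kappa>] by auto
    have "\<kappa>' = \<kappa> \<circ> \<tau>"
    proof
      fix v show "\<kappa>' v = (\<kappa> \<circ> \<tau>) v"
        using \<tau> that assms(4) by (cases "v \<in> A") (auto simp: permutes_not_in PiE_def extensional_def)
    qed
    then show ?thesis using inv[OF assms(4) \<tau>(1)] by simp
  qed
  then have "(\<Sum>\<kappa>'\<in>?W. F \<kappa>') = of_nat (card ?W) * F \<kappa>" by simp
  moreover have "(\<Sum>\<kappa>'\<in>?W. F \<kappa>') = 0" using wsum_content_sums_zero[OF assms(1-4)] .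
  moreover have "finite ?W" by (rule finite_subset[of _ "A \<rightarrow>\<^sub>E C"]) (use assms in \<open>auto intro: finite_PiE\<close>)
  then have "card ?W \<noteq> 0" using assms(4) by (auto simp: card_eq_0_iff)
  ultimately show ?thesis by simp
qed

section \<open>Types of set partitions\<close>

lemma permute_blocks:
  assumes "\<pi> \<in> set_partitions d" "\<tau> permutes {1..<d}" "1 \<le> d"
  shows "(`) \<tau> ` \<pi> \<in> set_partitions d" "partition_type d ((`) \<tau> ` \<pi>) = partition_type d \<pi>"
proof -
  have \<pi>: "partition_on {1..d} \<pi>" using assms(1) by (simp add: set_partitions_def)
  have inj: "inj \<tau>" using assms(2) by (rule permutes_inj)
  have \<tau>d: "\<tau> permutes {1..d}" using assms(2) by (rule permutes_subset) auto
  have "(`) \<tau> ` \<pi> - {{}} = (`) \<tau> ` \<pi>" using partition_onD3[OF \<pi>] by auto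
  then have part: "partition_on {1..d} ((`) \<tau> ` \<pi>)"
    using partition_on_inj_image[OF \<pi>, of \<tau>] permutes_image[OF \<tau>d] permutes_inj_on[OF \<tau>d] by simp
  then show "(`) \<tau> ` \<pi> \<in> set_partitions d" by (simp add: set_partitions_def)
  let ?D = "block \<pi> d"
  have D: "?D \<in> \<pi>" "d \<in> ?D" using partition_block[OF \<pi>, of d] assms(3) by simp_all
  have "\<tau> d = d" using assms(2) by (simp add: permutes_not_in)
  then have "d \<in> \<tau> ` ?D" using D(2) by force
  then have blk: "block ((`) \<tau> ` \<pi>) d = \<tau> ` ?D"
    using block_eq[OF part, of "\<tau> ` ?D" d] D(1) by blast
  have inj2: "inj ((`) \<tau>)" using inj by (intro inj_on_image) (auto intro: inj_on_subset)
  then have "(`) \<tau> ` \<pi> - {\<tau> ` ?D} = (`) \<tau> ` (\<pi> - {?D})"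
    by (simp add: image_set_diff)
  moreover have "image_mset card (mset_set ((`) \<tau> ` (\<pi> - {?D}))) = image_mset card (mset_set (\<pi> - {?D}))"
    using inj2 inj image_mset_mset_set[of "(`) \<tau>" "\<pi> - {?D}", symmetric]
    by (simp add: multiset.map_comp comp_def card_image inj_on_subset)
  ultimately show "partition_type d ((`) \<tau> ` \<pi>) = partition_type d \<pi>"
    using inj by (simp add: partition_type_def blk card_image inj_on_subset)
qed

lemma partition_with_block_sizes:
  assumes "finite A" "0 \<notin># la" "sum_mset la = card A"
  shows "\<exists>P. partition_on A P \<and> image_mset card (mset_set P) = la"
  using assms
proof (induction la arbitrary: A)
  case empty
  then show ?case by (intro exI[of _ "{}"]) (simp add: partition_on_empty)
next
  case (add c la)
  obtain B where B: "B \<subseteq> A" "card B = c"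
    using obtain_subset_with_card_n[of c A] add.prems(3) by auto
  have "card (A - B) = sum_mset la"
    using B add.prems by (simp add: card_Diff_subset finite_subset)
  then obtain P where P: "partition_on (A - B) P" "image_mset card (mset_set P) = la"
    using add.IH[of "A - B"] add.prems by auto
  have "B \<noteq> {}" using B add.prems by auto
  have dj: "disjnt B (\<Union>P)" using partition_onD1[OF P(1)] by (auto simp: disjnt_def)
  have "finite P" using finite_elements[OF _ P(1)] add.prems by simp
  moreover have "B \<notin> P" using dj \<open>B \<noteq> {}\<close> by (auto simp: disjnt_def)
  ultimately have "image_mset card (mset_set (insert B P)) = add_mset c la"
    using P(2) B by simp
  moreover have "partition_on A (insert B P)"
    using P B \<open>B \<noteq> {}\<close> by (simp add: partition_on_insert[OF dj])
  ultimately show ?case by blast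
qed

lemma partition_of_type:
  assumes "t \<in> type_index d"
  shows "\<exists>\<pi>\<in>set_partitions d. partition_type d \<pi> = t"
proof -
  obtain la b where t: "t = (la, b)" "0 \<notin># la" "1 \<le> b" "sum_mset la + b = d"
    using assms by (auto simp: type_index_def)
  obtain P where P: "partition_on {1..d - b} P" "image_mset card (mset_set P) = la"
    using partition_with_block_sizes[of "{1..d - b}" la] t by auto
  let ?B = "{d - b + 1..d}"
  have eq: "{1..d} - ?B = {1..d - b}" using t by auto
  have dj: "disjnt ?B (\<Union>P)"
    unfolding partition_onD1[OF P(1), symmetric] by (auto simp: disjnt_def)
  have part: "partition_on {1..d} (insert ?B P)"
    unfolding partition_on_insert[OF dj] eq using P(1) t(3,4) by auto
  moreover have "block (insert ?B P) d = ?B"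
    using t by (intro block_eq[OF part]) auto
  moreover have "?B \<notin> P"
  proof
    assume "?B \<in> P"
    then have "?B \<subseteq> \<Union>P" by blast
    then have "?B = {}" using dj unfolding disjnt_def by blast
    then show False using t by simp
  qed
  ultimately show ?thesis
    using P t by (intro bexI[of _ "insert ?B P"]) (auto simp: partition_type_def set_partitions_def)
qed

lemma partition_type_in_index:
  assumes "\<pi> \<in> set_partitions d" "1 \<le> d"
  shows "partition_type d \<pi> \<in> type_index d"
proof -
  have \<pi>: "partition_on {1..d} \<pi>" using assms(1) by (simp add: set_partitions_def)
  let ?D = "block \<pi> d"
  have D: "?D \<in> \<pi>" "d \<in> ?D" using partition_block[OF \<pi>, of d] assms(2) by simp_all
  have fin: "finite \<pi>" using finite_elements[OF _ \<pi>] by simp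
  have finB: "finite B" if "B \<in> \<pi>" for B
    using partition_onD1[OF \<pi>] that by (metis Sup_upper finite_atLeastAtMost finite_subset)
  have "d = card (\<Union>\<pi>)" using arg_cong[OF partition_onD1[OF \<pi>], of card] by simp
  also have "\<dots> = (\<Sum>B\<in>\<pi>. card B)"
    using partition_onD2[OF \<pi>] finB by (intro card_Union_disjoint)
  also have "\<dots> = (\<Sum>B\<in>\<pi> - {?D}. card B) + card ?D"
    using fin D(1) by (simp add: sum.remove)
  finally have "(\<Sum>B\<in>\<pi> - {?D}. card B) + card ?D = d" by simp
  moreover have "0 < card B" if "B \<in> \<pi>" for B
    using finB[OF that] partition_onD3[OF \<pi>] that by (metis card_gt_0_iff)
  then have "0 \<notin> card ` (\<pi> - {?D})" "1 \<le> card ?D" using D(1) by (force, simp add: Suc_leI)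
  ultimately show ?thesis
    using fin by (simp add: type_index_def partition_type_def sum_unfold_sum_mset)
qed

lemma finite_type_index: "finite (type_index d)"
proof (rule finite_subset)
  show "type_index d \<subseteq> partition_type d ` set_partitions d"
    using partition_of_type by blast
qed (simp add: finite_set_partitions)

lemma sum_by_type:
  assumes "1 \<le> d"
  shows "(\<Sum>t\<in>type_index d. (\<Sum>\<pi> | \<pi> \<in> set_partitions d \<and> partition_type d \<pi> = t. c \<pi>) * G t)
    = (\<Sum>\<pi>\<in>set_partitions d. c \<pi> * (G (partition_type d \<pi>) :: rat))"
proof -
  have "(\<Sum>\<pi>\<in>set_partitions d. c \<pi> * G (partition_type d \<pi>))
      = (\<Sum>t\<in>type_index d. \<Sum>\<pi> | \<pi> \<in> set_partitions d \<and> partition_type d \<pi> = t. c \<pi> * G (partition_type d \<pi>))"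
    using finite_set_partitions finite_type_index partition_type_in_index assms
    by (intro sum.group[symmetric]) auto
  also have "\<dots> = (\<Sum>t\<in>type_index d. (\<Sum>\<pi> | \<pi> \<in> set_partitions d \<and> partition_type d \<pi> = t. c \<pi>) * G t)"
    unfolding sum_distrib_right by (intro sum.cong) auto
  finally show ?thesis by simp
qed

text \<open>A relation among the images is lifted to a combination of the e_pi that is symmetric in
  all positions but the last. For such a combination, vanishing of the weighted sums forces
  vanishing at every single colouring, and independence of the e_pi finishes.\<close>

lemma e_terms_independent:
  assumes C: "{1..d} \<subseteq> C" "finite C" "0 \<notin> C" and d: "1 \<le> d"
    and zero: "\<And>x j. j \<in> C \<Longrightarrow> (\<Sum>t\<in>type_index d. a t * e_term C x j t) = 0"
    and t: "t \<in> type_index d"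
  shows "a t = 0"
proof -
  let ?P = "set_partitions d" and ?A = "{1..<d}"
  define N where "N t = card {\<pi> \<in> ?P. partition_type d \<pi> = t}" for t
  have N: "N t \<noteq> 0" if "t \<in> type_index d" for t
    using partition_of_type[OF that] finite_set_partitions by (auto simp: N_def)
  \<comment> \<open>Spreading each coefficient evenly over the partitions of its type makes \<open>F j\<close> invariant under
    permuting all positions but the last, which is what commuting those letters forgets.\<close>
  define c where "c \<pi> = a (partition_type d \<pi>) / of_nat (N (partition_type d \<pi>))" for \<pi>
  define F where "F j \<kappa> = (\<Sum>\<pi>\<in>?P. c \<pi> * of_bool (\<forall>B\<in>\<pi>. inj_on (\<kappa>(d := j)) B))" for j and \<kappa> :: "nat \<Rightarrow> nat"
  have csum: "(\<Sum>\<pi> | \<pi> \<in> ?P \<and> partition_type d \<pi> = t. c \<pi>) = a t" if "t \<in> type_index d" for t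
    using N[OF that] by (simp add: c_def N_def)
  have wsum0: "wsum C x ?A (F j) = 0" if j: "j \<in> C" for x j
  proof -
    have "wsum C x ?A (F j)
        = (\<Sum>\<pi>\<in>?P. c \<pi> * wsum C x ?A (\<lambda>\<kappa>. of_bool (\<forall>B\<in>\<pi>. inj_on (\<kappa>(d := j)) B)))"
      unfolding F_def wsum_sum wsum_cmult ..
    also have "\<dots> = (\<Sum>\<pi>\<in>?P. c \<pi> * e_term C x j (partition_type d \<pi>))"
    proof (intro sum.cong refl arg_cong2[where f = "(*)"])
      fix \<pi> assume "\<pi> \<in> ?P"
      then have \<pi>: "partition_on {1..d} \<pi>" by (simp add: set_partitions_def)
      have "wsum C x ?A (\<lambda>\<kappa>. of_bool (\<forall>B\<in>\<pi>. inj_on (\<kappa>(d := j)) B)) = phi C d (nc_e d \<pi>) x j"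
        unfolding nc_e_eq_word_indicator[OF \<pi>]
        using C d j partition_onD1[OF \<pi>] by (intro phi_word_indicator[symmetric] inj_on_blocks_cong) auto
      then show "wsum C x ?A (\<lambda>\<kappa>. of_bool (\<forall>B\<in>\<pi>. inj_on (\<kappa>(d := j)) B)) = e_term C x j (partition_type d \<pi>)"
        using phi_nc_e[OF \<pi> C(3,2) j d] by simp
    qed
    also have "\<dots> = (\<Sum>t\<in>type_index d. a t * e_term C x j t)"
      unfolding sum_by_type[OF d, symmetric] using csum by (intro sum.cong) auto
    finally show ?thesis using zero[OF j] by simp
  qed
  have F0: "F j \<kappa> = 0" if "j \<in> C" "\<kappa> \<in> ?A \<rightarrow>\<^sub>E C" for j \<kappa>
  proof (rule symmetric_wsum_zero[OF _ C(2) wsum0[OF that(1)] that(2)])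
    fix \<kappa> :: "nat \<Rightarrow> nat" and \<tau> assume \<tau>: "\<tau> permutes ?A"
    have \<tau>': "inv \<tau> permutes ?A" using \<tau> by (rule permutes_inv)
    have \<tau>d: "\<tau> i = d \<longleftrightarrow> i = d" for i
      using \<tau> permutes_inj[OF \<tau>] permutes_not_in[OF \<tau>, of d] by (auto simp: inj_def)
    have upd: "(\<kappa> \<circ> \<tau>)(d := j) = \<kappa>(d := j) \<circ> \<tau>" by (auto simp: fun_eq_iff \<tau>d)
    have inv: "(`) (inv \<tau>) ` (`) \<tau> ` \<pi> = \<pi>" "(`) \<tau> ` (`) (inv \<tau>) ` \<pi> = \<pi>" for \<pi>
      using permutes_inv_o[OF \<tau>] by (simp_all add: image_comp comp_def flip: image_comp) (simp_all add: image_image permutes_inverses[OF \<tau>])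
    \<comment> \<open>Composing with a permutation of the first d - 1 positions replaces each block
      by its image. This permutes the set partitions and keeps types, hence the coefficients
      \<open>c\<close>.\<close>
    have "F j (\<kappa> \<circ> \<tau>) = (\<Sum>\<pi>\<in>?P. c ((`) \<tau> ` \<pi>) * of_bool (\<forall>B\<in>(`) \<tau> ` \<pi>. inj_on (\<kappa>(d := j)) B))"
      unfolding F_def upd
    proof (intro sum.cong refl)
      fix \<pi> assume "\<pi> \<in> ?P"
      moreover have "inj_on (\<kappa>(d := j) \<circ> \<tau>) B \<longleftrightarrow> inj_on (\<kappa>(d := j)) (\<tau> ` B)" for B
        using comp_inj_on_iff[OF permutes_inj_on[OF \<tau>]] by metis
      ultimately show "c \<pi> * of_bool (\<forall>B\<in>\<pi>. inj_on (\<kappa>(d := j) \<circ> \<tau>) B)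
          = c ((`) \<tau> ` \<pi>) * of_bool (\<forall>B\<in>(`) \<tau> ` \<pi>. inj_on (\<kappa>(d := j)) B)"
        using permute_blocks(2)[OF _ \<tau> d] by (simp add: c_def)
    qed
    also have "\<dots> = F j \<kappa>"
      unfolding F_def
      by (rule sum.reindex_bij_witness[where i = "\<lambda>\<pi>. (`) (inv \<tau>) ` \<pi>" and j = "\<lambda>\<pi>. (`) \<tau> ` \<pi>"])
        (simp_all add: inv permute_blocks(1)[OF _ \<tau> d] permute_blocks(1)[OF _ \<tau>' d])
    finally show "F j (\<kappa> \<circ> \<tau>) = F j \<kappa>" .
  qed simp
  obtain \<pi> where \<pi>: "\<pi> \<in> ?P" "partition_type d \<pi> = t" using partition_of_type[OF t] by blast
  have "c \<pi> = 0"
  proof (rule nc_e_coeffs_zero[OF _ \<pi>(1)])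
    fix \<kappa> :: "nat \<Rightarrow> nat" assume \<kappa>: "\<And>i. i \<in> {1..d} \<Longrightarrow> \<kappa> i \<in> {1..d}"
    \<comment> \<open>The last letter of the test colouring plays the part of \<open>j\<close>;
      \<open>restrict\<close> drops it from the weighted positions.\<close>
    have "F (\<kappa> d) (restrict \<kappa> ?A) = 0"
      using \<kappa> C(1) d by (intro F0) auto
    moreover have "F (\<kappa> d) (restrict \<kappa> ?A) = (\<Sum>\<pi>\<in>?P. c \<pi> * of_bool (\<forall>B\<in>\<pi>. inj_on \<kappa> B))"
      unfolding F_def
    proof (intro sum.cong refl arg_cong2[where f = "(*)"] arg_cong[where f = of_bool] inj_on_blocks_cong)
      fix \<pi> i assume "\<pi> \<in> ?P" "i \<in> \<Union>\<pi>"
      then have "i \<in> {1..d}" by (auto simp: set_partitions_def partition_on_def)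
      then show "((restrict \<kappa> ?A)(d := \<kappa> d)) i = \<kappa> i" by auto
    qed
    ultimately show "(\<Sum>\<pi>\<in>?P. c \<pi> * of_bool (\<forall>B\<in>\<pi>. inj_on \<kappa> B)) = 0" by simp
  qed
  then show ?thesis using N[OF t] \<pi>(2) by (simp add: c_def)
qed

section \<open>Concatenation as a linear operator\<close>

text \<open>The coefficients are chosen once for all \<open>x\<close> and \<open>j\<close>.
  Existence of some nonnegative expansion is asked for, so closure under sums and scaling is
  immediate and uniqueness enters only in \<open>e_positive_if_cone\<close>.\<close>

definition e_cone :: "nat set \<Rightarrow> nat \<Rightarrow> ((nat \<Rightarrow> rat) \<Rightarrow> nat \<Rightarrow> rat) set" where
  "e_cone C d = {F. \<exists>a. (\<forall>t\<in>type_index d. 0 \<le> a t) \<and>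
     (\<forall>x. \<forall>j\<in>C. F x j = (\<Sum>t\<in>type_index d. a t * e_term C x j t))}"

lemma e_cone_e_term: "t \<in> type_index d \<Longrightarrow> (\<lambda>x j. e_term C x j t) \<in> e_cone C d"
  unfolding e_cone_def
  by (intro CollectI exI[of _ "\<lambda>s. of_bool (s = t)"])
    (simp add: finite_type_index of_bool_def if_distrib[of "\<lambda>c. c * _"] cong: if_cong)

lemma e_cone_zero: "(\<lambda>x j. 0) \<in> e_cone C d"
  unfolding e_cone_def by (intro CollectI exI[of _ "\<lambda>_. 0"]) simp

lemma e_cone_add:
  assumes "F \<in> e_cone C d" "G \<in> e_cone C d"
  shows "(\<lambda>x j. F x j + G x j) \<in> e_cone C d"
proof -
  obtain a b where "\<forall>t\<in>type_index d. 0 \<le> a t" "\<forall>x. \<forall>j\<in>C. F x j = (\<Sum>t\<in>type_index d. a t * e_term C x j t)"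
    "\<forall>t\<in>type_index d. 0 \<le> b t" "\<forall>x. \<forall>j\<in>C. G x j = (\<Sum>t\<in>type_index d. b t * e_term C x j t)"
    using assms unfolding e_cone_def by blast
  then show ?thesis
    unfolding e_cone_def
    by (intro CollectI exI[of _ "\<lambda>t. a t + b t"]) (simp add: distrib_right sum.distrib)
qed

lemma e_cone_scale:
  assumes "F \<in> e_cone C d" "0 \<le> c"
  shows "(\<lambda>x j. c * F x j) \<in> e_cone C d"
proof -
  obtain a where "\<forall>t\<in>type_index d. 0 \<le> a t" "\<forall>x. \<forall>j\<in>C. F x j = (\<Sum>t\<in>type_index d. a t * e_term C x j t)"
    using assms unfolding e_cone_def by blast
  then show ?thesis
    unfolding e_cone_def using assms(2)
    by (intro CollectI exI[of _ "\<lambda>t. c * a t"]) (simp add: sum_distrib_left mult.assoc)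
qed

lemma e_cone_sum:
  "(\<And>s. s \<in> S \<Longrightarrow> F s \<in> e_cone C d) \<Longrightarrow> (\<lambda>x j. \<Sum>s\<in>S. F s x j) \<in> e_cone C d"
  by (induction S rule: infinite_finite_induct) (simp_all add: e_cone_zero e_cone_add)

lemma e_cone_cong:
  "F \<in> e_cone C d \<Longrightarrow> (\<And>x j. j \<in> C \<Longrightarrow> F x j = G x j) \<Longrightarrow> G \<in> e_cone C d"
  unfolding e_cone_def by simp

section \<open>Chromatic series of labelled graphs\<close>

definition proper :: "nat set set \<Rightarrow> (nat \<Rightarrow> nat) \<Rightarrow> bool" where
  "proper E \<kappa> \<longleftrightarrow> (\<forall>i j. {i, j} \<in> E \<longrightarrow> \<kappa> i \<noteq> \<kappa> j)"

lemma complete_edgesI: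
  "i \<in> {1..d} \<Longrightarrow> j \<in> {1..d} \<Longrightarrow> i \<noteq> j \<Longrightarrow> {i, j} \<in> complete_edges d"
  unfolding complete_edges_def by blast

lemma edge_endpoints:
  assumes "E \<subseteq> complete_edges d" "{i, j} \<in> E"
  shows "i \<in> {1..d}" "j \<in> {1..d}"
  using assms by (auto simp: complete_edges_def doubleton_eq_iff)

lemma proper_cong:
  assumes "E \<subseteq> complete_edges d" "\<And>i. i \<in> {1..d} \<Longrightarrow> \<kappa> i = \<kappa>' i"
  shows "proper E \<kappa> = proper E \<kappa>'"
  unfolding proper_def using assms(2) edge_endpoints[OF assms(1)] by metis

lemma chromatic_Y_eq:
  assumes "labelled_graph G"
  shows "chromatic_Y G = word_indicator (nverts G) (proper (edges G))"
proof -
  have E: "edges G \<subseteq> complete_edges (nverts G)" using assms by (simp add: labelled_graph_def)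
  show ?thesis
    unfolding chromatic_Y_def proper_colourings_def
    unfolding proper_def[symmetric]
    by (intro monomial_sum_eq_word_indicator proper_cong[OF E])
qed

text \<open>Properness is a condition on the equality pattern of the colouring. Membership in the
  span is what makes \<open>nc.representation\<close>, and with it \<open>nu\<close>, an actual
  expansion of Y_G.\<close>

lemma chromatic_Y_in_span:
  assumes "labelled_graph G"
  shows "chromatic_Y G \<in> e_span (nverts G)"
proof -
  let ?d = "nverts G"
  have E: "edges G \<subseteq> complete_edges ?d" using assms by (simp add: labelled_graph_def)
  have "proper (edges G) = (\<lambda>\<kappa>. \<forall>i j. {i, j} \<in> edges G \<longrightarrow> (i, j) \<notin> eqrel ?d \<kappa>)"
    unfolding proper_def eqrel_def using edge_endpoints[OF E] by (auto simp: fun_eq_iff)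
  then show ?thesis
    unfolding chromatic_Y_eq[OF assms]
    using word_indicator_in_span[of ?d "\<lambda>r. \<forall>i j. {i, j} \<in> edges G \<longrightarrow> (i, j) \<notin> r"] by simp
qed

text \<open>\<open>phi\<close> takes the same value on all e_pi of one type, and the coefficient of
  y_G at that type is the sum of their coefficients. This is the factorisation of \<open>phi\<close>
  through \<open>nu\<close>.\<close>

lemma phi_chromatic_Y:
  assumes G: "labelled_graph G" and C: "0 \<notin> C" "finite C" "j \<in> C"
  shows "phi C (nverts G) (chromatic_Y G) x j
    = (\<Sum>t\<in>type_index (nverts G). Poly_Mapping.lookup (chromatic_y G) t * e_term C x j t)"
proof -
  let ?d = "nverts G" and ?P = "set_partitions (nverts G)" and ?Y = "chromatic_Y G"
  define c where "c \<pi> = nc.representation (nc_e ?d ` ?P) ?Y (nc_e ?d \<pi>)" for \<pi>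
  have d: "1 \<le> ?d" using G by (simp add: labelled_graph_def)
  have "?Y = (\<Sum>v\<in>nc_e ?d ` ?P. nc_scale (nc.representation (nc_e ?d ` ?P) ?Y v) v)"
    using nc.sum_representation_eq[OF independent_nc_e chromatic_Y_in_span[OF G]]
      finite_set_partitions by simp
  also have "\<dots> = (\<Sum>\<pi>\<in>?P. nc_scale (c \<pi>) (nc_e ?d \<pi>))"
    by (simp add: sum.reindex[OF inj_nc_e] c_def)
  finally have "phi C ?d ?Y x j = (\<Sum>\<pi>\<in>?P. c \<pi> * phi C ?d (nc_e ?d \<pi>) x j)"
    by (simp only: phi_sum)
  also have "\<dots> = (\<Sum>\<pi>\<in>?P. c \<pi> * e_term C x j (partition_type ?d \<pi>))"
    using C d by (intro sum.cong) (auto simp: phi_nc_e set_partitions_def)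
  also have "\<dots> = (\<Sum>t\<in>type_index ?d. (\<Sum>\<pi> | \<pi> \<in> ?P \<and> partition_type ?d \<pi> = t. c \<pi>) * e_term C x j t)"
    by (rule sum_by_type[OF d, symmetric])
  also have "\<dots> = (\<Sum>t\<in>type_index ?d. Poly_Mapping.lookup (chromatic_y G) t * e_term C x j t)"
  proof (intro sum.cong refl arg_cong2[where f = "(*)"])
    fix t
    have "Poly_Mapping.lookup (chromatic_y G) t = (\<Sum>\<pi>\<in>?P. if partition_type ?d \<pi> = t then c \<pi> else 0)"
      unfolding chromatic_y_def nu_def lookup_sum lookup_single when_def c_def ..
    also have "\<dots> = (\<Sum>\<pi> | \<pi> \<in> ?P \<and> partition_type ?d \<pi> = t. c \<pi>)"
      by (intro sum.inter_filter[symmetric] finite_set_partitions)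
    finally show "(\<Sum>\<pi> | \<pi> \<in> ?P \<and> partition_type ?d \<pi> = t. c \<pi>) = Poly_Mapping.lookup (chromatic_y G) t" by simp
  qed
  finally show ?thesis .
qed

lemma e_positive_if_cone:
  assumes G: "labelled_graph G" and C: "{1..nverts G} \<subseteq> C" "finite C" "0 \<notin> C"
    and cone: "phi C (nverts G) (chromatic_Y G) \<in> e_cone C (nverts G)"
  shows "e_positive G"
  unfolding e_positive_def
proof
  fix t assume t: "t \<in> type_index (nverts G)"
  let ?T = "type_index (nverts G)" and ?y = "Poly_Mapping.lookup (chromatic_y G)"
  have d: "1 \<le> nverts G" using G by (simp add: labelled_graph_def)
  obtain a where a: "\<forall>t\<in>?T. 0 \<le> a t"
    "\<forall>x. \<forall>j\<in>C. phi C (nverts G) (chromatic_Y G) x j = (\<Sum>t\<in>?T. a t * e_term C x j t)"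
    using cone unfolding e_cone_def by blast
  have "(\<Sum>t\<in>?T. (?y t - a t) * e_term C x j t) = 0" if "j \<in> C" for x j
    using a(2) phi_chromatic_Y[OF G C(3,2) that, of x] that
    by (simp add: left_diff_distrib sum_subtractf)
  from e_terms_independent[OF C d this t] have "?y t = a t" by simp
  then show "0 \<le> ?y t" using a(1) t by simp
qed

lemma proper_Un: "proper (E \<union> E') \<kappa> \<longleftrightarrow> proper E \<kappa> \<and> proper E' \<kappa>"
  by (auto simp: proper_def)

lemma proper_image:
  assumes "E \<subseteq> complete_edges d"
  shows "proper ((\<lambda>e. s ` e) ` E) \<kappa> \<longleftrightarrow> proper E (\<lambda>a. \<kappa> (s a))"
proof -
  have "{u, v} \<in> (\<lambda>e. s ` e) ` E \<longleftrightarrow> (\<exists>a b. {a, b} \<in> E \<and> u = s a \<and> v = s b)" for u v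
  proof
    assume "{u, v} \<in> (\<lambda>e. s ` e) ` E"
    then obtain e where e: "e \<in> E" "{u, v} = s ` e" by auto
    then obtain a b where ab: "e = {a, b}"
      using assms by (auto simp: complete_edges_def)
    then have "{b, a} \<in> E" "{a, b} \<in> E" using e by (simp_all add: insert_commute)
    moreover have "{u, v} = {s a, s b}" using e ab by simp
    ultimately show "\<exists>a b. {a, b} \<in> E \<and> u = s a \<and> v = s b"
      unfolding doubleton_eq_iff by blast
  next
    assume "\<exists>a b. {a, b} \<in> E \<and> u = s a \<and> v = s b"
    then show "{u, v} \<in> (\<lambda>e. s ` e) ` E" by (auto intro: rev_image_eqI)
  qed
  then show ?thesis unfolding proper_def by (simp only:) blast
qed

section \<open>Cutting a concatenation at the shared vertex\<close>

definition shifted_proper :: "nat \<Rightarrow> lgraph \<Rightarrow> (nat \<Rightarrow> nat) \<Rightarrow> bool" where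
  "shifted_proper n H \<kappa> \<longleftrightarrow> proper (edges H) (\<lambda>a. \<kappa> (n - 1 + a))"

text \<open>The kernel of the concatenation operator: \<open>i\<close> and \<open>j\<close> are the
  colours of the first and last vertex of \<open>H\<close>, and only the vertices strictly between
  them are weighted. The weight of the shared vertex is added in \<open>phi_concat\<close>; the last
  vertex has none under \<open>phi\<close>.\<close>

definition transfer :: "nat set \<Rightarrow> (nat \<Rightarrow> rat) \<Rightarrow> nat \<Rightarrow> lgraph \<Rightarrow> nat \<Rightarrow> nat \<Rightarrow> rat" where
  "transfer C x n H i j = (let d = n + nverts H - 1 in
     wsum C x {n + 1..<d} (\<lambda>\<kappa>. of_bool (shifted_proper n H (\<kappa>(n := i, d := j)))))"

lemma labelled_concat:
  assumes G: "labelled_graph G" and H: "labelled_graph H"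
  shows "labelled_graph (concat_graph G H)"
proof -
  let ?n = "nverts G" and ?m = "nverts H"
  have nm: "1 \<le> ?n" "1 \<le> ?m" using G H by (simp_all add: labelled_graph_def)
  have "e \<in> complete_edges (?n + ?m - 1)" if "e \<in> edges G" for e
  proof -
    obtain i j where "e = {i, j}" "i \<in> {1..?n}" "j \<in> {1..?n}" "i \<noteq> j"
      using G \<open>e \<in> edges G\<close> by (auto simp: labelled_graph_def complete_edges_def)
    moreover from this have "i \<in> {1..?n + ?m - 1}" "j \<in> {1..?n + ?m - 1}" using nm by auto
    ultimately show ?thesis by (simp add: complete_edgesI)
  qed
  moreover have "(\<lambda>i. ?n - 1 + i) ` e \<in> complete_edges (?n + ?m - 1)" if "e \<in> edges H" for e
  proof -
    obtain i j where "e = {i, j}" "i \<in> {1..?m}" "j \<in> {1..?m}" "i \<noteq> j"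
      using H \<open>e \<in> edges H\<close> by (auto simp: labelled_graph_def complete_edges_def)
    moreover from this have "?n - 1 + i \<in> {1..?n + ?m - 1}" "?n - 1 + j \<in> {1..?n + ?m - 1}"
      "?n - 1 + i \<noteq> ?n - 1 + j" using nm by auto
    ultimately show ?thesis by (simp add: complete_edgesI)
  qed
  ultimately show ?thesis
    using nm by (auto simp: labelled_graph_def concat_graph_def)
qed

text \<open>Once the shared vertex has colour \<open>i\<close>, the rest of \<open>G\<close> and the
  rest of \<open>H\<close> are coloured independently.\<close>

lemma phi_concat:
  assumes G: "labelled_graph G" and H: "labelled_graph H" "2 \<le> nverts H"
    and C: "0 \<notin> C" "j \<in> C"
  shows "phi C (nverts (concat_graph G H)) (chromatic_Y (concat_graph G H)) x j
    = (\<Sum>i\<in>C. x i * phi C (nverts G) (chromatic_Y G) x i * transfer C x (nverts G) H i j)"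
proof -
  let ?n = "nverts G" and ?K = "concat_graph G H"
  define d where "d = ?n + nverts H - 1"
  let ?A = "{1..<?n}" and ?B = "{?n + 1..<d}"
  have n: "1 \<le> ?n" and EG: "edges G \<subseteq> complete_edges ?n"
    using G by (simp_all add: labelled_graph_def)
  have EH: "edges H \<subseteq> complete_edges (nverts H)" using H by (simp add: labelled_graph_def)
  have nd: "?n < d" using n H(2) by (simp add: d_def)
  have K: "labelled_graph ?K" using labelled_concat[OF G H(1)] .
  have dK: "nverts ?K = d" by (simp add: concat_graph_def d_def)
  have EK: "edges ?K \<subseteq> complete_edges d" using K dK by (simp add: labelled_graph_def)
  have proper_K: "proper (edges ?K) \<kappa> \<longleftrightarrow> proper (edges G) \<kappa> \<and> shifted_proper ?n H \<kappa>" for \<kappa>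
    unfolding concat_graph_def lgraph.sel proper_Un proper_image[OF EH] shifted_proper_def ..
  have "phi C d (chromatic_Y ?K) x j = wsum C x {1..<d} (\<lambda>\<kappa>. of_bool (proper (edges ?K) (\<kappa>(d := j))))"
    unfolding chromatic_Y_eq[OF K] dK
    using C nd by (intro phi_word_indicator proper_cong[OF EK]) auto
  also have "{1..<d} = insert ?n (?A \<union> ?B)" using n nd by auto
  also have "wsum C x (insert ?n (?A \<union> ?B)) (\<lambda>\<kappa>. of_bool (proper (edges ?K) (\<kappa>(d := j))))
      = (\<Sum>i\<in>C. x i * wsum C x (?A \<union> ?B) (\<lambda>\<kappa>. of_bool (proper (edges ?K) (\<kappa>(?n := i, d := j)))))"
    by (intro wsum_insert) auto
  also have "\<dots> = (\<Sum>i\<in>C. x i * (phi C ?n (chromatic_Y G) x i * transfer C x ?n H i j))"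
  proof (intro sum.cong refl arg_cong2[where f = "(*)"])
    fix i assume i: "i \<in> C"
    have "proper (edges G) (\<kappa>(?n := i, d := j)) = proper (edges G) (\<kappa>(?n := i))" for \<kappa>
      using nd by (intro proper_cong[OF EG]) auto
    then have "wsum C x (?A \<union> ?B) (\<lambda>\<kappa>. of_bool (proper (edges ?K) (\<kappa>(?n := i, d := j))))
        = wsum C x (?A \<union> ?B) (\<lambda>\<kappa>. of_bool (proper (edges G) (\<kappa>(?n := i)))
            * of_bool (shifted_proper ?n H (\<kappa>(?n := i, d := j))))"
      unfolding proper_K by (simp only: of_bool_conj)
    also have "\<dots> = wsum C x ?A (\<lambda>\<kappa>. of_bool (proper (edges G) (\<kappa>(?n := i))))
        * wsum C x ?B (\<lambda>\<kappa>. of_bool (shifted_proper ?n H (\<kappa>(?n := i, d := j))))"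
    proof (rule wsum_Un)
      show "of_bool (proper (edges G) (\<kappa>(?n := i))) = (of_bool (proper (edges G) (\<kappa>'(?n := i))) :: rat)"
        if "\<And>v. v \<in> ?A \<Longrightarrow> \<kappa> v = \<kappa>' v" for \<kappa> \<kappa>'
        using that by (intro arg_cong[where f = of_bool] proper_cong[OF EG]) auto
      show "of_bool (shifted_proper ?n H (\<kappa>(?n := i, d := j)))
          = (of_bool (shifted_proper ?n H (\<kappa>'(?n := i, d := j))) :: rat)"
        if "\<And>v. v \<in> ?B \<Longrightarrow> \<kappa> v = \<kappa>' v" for \<kappa> \<kappa>'
        unfolding shifted_proper_def
      proof (intro arg_cong[where f = of_bool] proper_cong[OF EH])
        fix a assume "a \<in> {1..nverts H}"
        then have "?n - 1 + a = ?n \<or> ?n - 1 + a = d \<or> ?n - 1 + a \<in> ?B"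
          using n unfolding d_def by auto
        then show "(\<kappa>(?n := i, d := j)) (?n - 1 + a) = (\<kappa>'(?n := i, d := j)) (?n - 1 + a)"
          using that by auto
      qed
    qed auto
    also have "wsum C x ?A (\<lambda>\<kappa>. of_bool (proper (edges G) (\<kappa>(?n := i)))) = phi C ?n (chromatic_Y G) x i"
      unfolding chromatic_Y_eq[OF G]
      using C i n by (intro phi_word_indicator[symmetric] proper_cong[OF EG]) auto
    finally show "wsum C x (?A \<union> ?B) (\<lambda>\<kappa>. of_bool (proper (edges ?K) (\<kappa>(?n := i, d := j))))
        = phi C ?n (chromatic_Y G) x i * transfer C x ?n H i j"
      unfolding transfer_def Let_def d_def .
  qed
  finally show ?thesis by (simp add: dK mult.assoc)
qed

text \<open>By linearity it is enough to put a single basis image in place of \<open>G\<close>,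
  because the coefficients of y_G are nonnegative.\<close>

lemma appendable_if_transfer:
  assumes H: "labelled_graph H" "2 \<le> nverts H"
    and cone: "\<And>C n t. finite C \<Longrightarrow> 0 \<notin> C \<Longrightarrow> 1 \<le> n \<Longrightarrow> t \<in> type_index n \<Longrightarrow>
      (\<lambda>x j. \<Sum>i\<in>C. x i * e_term C x i t * transfer C x n H i j) \<in> e_cone C (n + nverts H - 1)"
  shows "appendable_e_positive H"
  unfolding appendable_e_positive_def
proof (intro conjI allI impI H(1))
  fix G assume "labelled_graph G \<and> e_positive G"
  then have G: "labelled_graph G" and pos: "e_positive G" by auto
  let ?n = "nverts G" and ?K = "concat_graph G H" and ?y = "Poly_Mapping.lookup (chromatic_y G)"
  \<comment> \<open>The colours must cover the size of the concatenation, which varies with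
    \<open>G\<close>; hence the hypothesis is stated for every finite \<open>C\<close>.\<close>
  let ?C = "{1..nverts ?K}"
  have n: "1 \<le> ?n" using G by (simp add: labelled_graph_def)
  have "(\<lambda>x j. \<Sum>t\<in>type_index ?n. ?y t * (\<Sum>i\<in>?C. x i * e_term ?C x i t * transfer ?C x ?n H i j))
      \<in> e_cone ?C (nverts ?K)"
  proof (rule e_cone_sum)
    fix t assume t: "t \<in> type_index ?n"
    have "(\<lambda>x j. \<Sum>i\<in>?C. x i * e_term ?C x i t * transfer ?C x ?n H i j) \<in> e_cone ?C (nverts ?K)"
      using cone[of ?C ?n t] n t by (simp add: concat_graph_def)
    moreover have "0 \<le> ?y t" using pos t by (simp add: e_positive_def)
    ultimately show "(\<lambda>x j. ?y t * (\<Sum>i\<in>?C. x i * e_term ?C x i t * transfer ?C x ?n H i j))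
        \<in> e_cone ?C (nverts ?K)"
      by (rule e_cone_scale)
  qed
  then have "phi ?C (nverts ?K) (chromatic_Y ?K) \<in> e_cone ?C (nverts ?K)"
  proof (rule e_cone_cong)
    fix x j assume j: "j \<in> ?C"
    have "phi ?C (nverts ?K) (chromatic_Y ?K) x j
        = (\<Sum>i\<in>?C. x i * phi ?C ?n (chromatic_Y G) x i * transfer ?C x ?n H i j)"
      using j by (intro phi_concat[OF G H]) auto
    also have "\<dots> = (\<Sum>i\<in>?C. \<Sum>t\<in>type_index ?n. ?y t * (x i * e_term ?C x i t * transfer ?C x ?n H i j))"
    proof (rule sum.cong[OF refl])
      fix i assume "i \<in> ?C"
      then have "phi ?C ?n (chromatic_Y G) x i = (\<Sum>t\<in>type_index ?n. ?y t * e_term ?C x i t)"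
        by (intro phi_chromatic_Y[OF G]) auto
      then show "x i * phi ?C ?n (chromatic_Y G) x i * transfer ?C x ?n H i j
          = (\<Sum>t\<in>type_index ?n. ?y t * (x i * e_term ?C x i t * transfer ?C x ?n H i j))"
        by (simp add: sum_distrib_left sum_distrib_right mult_ac)
    qed
    also have "\<dots> = (\<Sum>t\<in>type_index ?n. ?y t * (\<Sum>i\<in>?C. x i * e_term ?C x i t * transfer ?C x ?n H i j))"
      unfolding sum_distrib_left by (rule sum.swap)
    finally show "(\<Sum>t\<in>type_index ?n. ?y t * (\<Sum>i\<in>?C. x i * e_term ?C x i t * transfer ?C x ?n H i j))
        = phi ?C (nverts ?K) (chromatic_Y ?K) x j" by simp
  qed
  then show "e_positive ?K"
    by (intro e_positive_if_cone[OF labelled_concat[OF G H(1)]]) auto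
qed

section \<open>Melting ice cream scoops\<close>

lemma labelled_ice_cream: "labelled_graph (ice_cream (Suc m) k)"
  by (auto simp: labelled_graph_def ice_cream_def)

lemma labelled_reverse:
  assumes "labelled_graph G"
  shows "labelled_graph (reverse_graph G)"
proof -
  have "(\<lambda>i. nverts G + 1 - i) ` e \<in> complete_edges (nverts G)" if "e \<in> edges G" for e
  proof -
    have "e \<in> complete_edges (nverts G)" using assms that by (auto simp: labelled_graph_def)
    then obtain i j where "e = {i, j}" "i \<in> {1..nverts G}" "j \<in> {1..nverts G}" "i \<noteq> j"
      by (auto simp: complete_edges_def)
    moreover from this have "nverts G + 1 - i \<in> {1..nverts G}" "nverts G + 1 - j \<in> {1..nverts G}"
      "nverts G + 1 - i \<noteq> nverts G + 1 - j" by auto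
    ultimately show ?thesis by (simp add: complete_edgesI del: One_nat_def)
  qed
  then show ?thesis using assms by (auto simp: labelled_graph_def reverse_graph_def)
qed

lemma proper_ice_cream:
  "proper (edges (ice_cream (Suc m) k)) f \<longleftrightarrow> inj_on f {1..m} \<and> f (Suc m) \<notin> f ` {Suc k..m}"
proof
  assume P: "proper (edges (ice_cream (Suc m) k)) f"
  have "f a \<noteq> f b" if "a \<in> {1..m}" "b \<in> {1..m}" "a \<noteq> b" for a b
  proof -
    have "{a, b} \<in> edges (ice_cream (Suc m) k)"
      using that by (auto simp: ice_cream_def doubleton_eq_iff intro!: complete_edgesI)
    then show ?thesis using P by (auto simp: proper_def)
  qed
  then have "inj_on f {1..m}" by (meson inj_onI)
  moreover have "f a \<noteq> f (Suc m)" if "a \<in> {Suc k..m}" for a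
  proof -
    have "{a, Suc m} \<in> edges (ice_cream (Suc m) k)"
      using that by (auto simp: ice_cream_def doubleton_eq_iff intro!: complete_edgesI)
    then show ?thesis using P by (auto simp: proper_def)
  qed
  ultimately show "inj_on f {1..m} \<and> f (Suc m) \<notin> f ` {Suc k..m}" by force
next
  assume R: "inj_on f {1..m} \<and> f (Suc m) \<notin> f ` {Suc k..m}"
  show "proper (edges (ice_cream (Suc m) k)) f"
    unfolding proper_def
  proof (intro allI impI)
    fix a b assume e: "{a, b} \<in> edges (ice_cream (Suc m) k)"
    then have ab: "a \<in> {1..Suc m}" "b \<in> {1..Suc m}" "a \<noteq> b"
      by (auto simp: ice_cream_def complete_edges_def doubleton_eq_iff)
    have no: "\<not> (b = Suc m \<and> a \<in> {1..k})" "\<not> (a = Suc m \<and> b \<in> {1..k})"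
      using e by (auto simp: ice_cream_def insert_commute)
    consider "a \<in> {1..m}" "b \<in> {1..m}" | "a = Suc m" "b \<in> {Suc k..m}" | "b = Suc m" "a \<in> {Suc k..m}"
      using ab no by fastforce
    then show "f a \<noteq> f b"
    proof cases
      case 1
      then show ?thesis using R ab(3) by (meson inj_onD)
    next
      case 2
      then show ?thesis using R by (metis imageI)
    next
      case 3
      then show ?thesis using R by (metis imageI)
    qed
  qed
qed

lemma proper_reverse_ice_cream:
  assumes "k \<le> m"
  shows "proper (edges (reverse_graph (ice_cream (Suc m) k))) f
    \<longleftrightarrow> inj_on f {2..Suc m} \<and> f 1 \<notin> f ` {2..Suc m - k}"
proof -
  let ?r = "\<lambda>i. Suc m + 1 - i"
  have sub: "edges (ice_cream (Suc m) k) \<subseteq> complete_edges (Suc m)"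
    by (auto simp: ice_cream_def)
  have "?r ` {a..b} = {?r b..?r a}" if "b \<le> Suc m" for a b
  proof (intro equalityI subsetI)
    fix i assume "i \<in> {?r b..?r a}"
    then have "i = ?r (?r i)" "?r i \<in> {a..b}" using that by auto
    then show "i \<in> ?r ` {a..b}" by (rule image_eqI)
  qed auto
  from this[of m 1] this[of m "Suc k"]
  have im: "?r ` {1..m} = {2..Suc m}" "?r ` {Suc k..m} = {2..Suc m - k}"
    by (simp_all add: numeral_2_eq_2 Suc_diff_le)
  have "inj_on ?r {1..m}" by (auto simp: inj_on_def)
  then have "inj_on (\<lambda>a. f (?r a)) {1..m} \<longleftrightarrow> inj_on f {2..Suc m}"
    using comp_inj_on_iff[of ?r "{1..m}" f] unfolding im comp_def by blast
  moreover have "(\<lambda>a. f (?r a)) ` {Suc k..m} = f ` {2..Suc m - k}"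
    by (simp add: im image_image flip: im(2))
  ultimately show ?thesis
    unfolding reverse_graph_def lgraph.sel
    by (simp add: proper_image[OF sub] proper_ice_cream) (simp add: ice_cream_def proper_image[OF sub] proper_ice_cream)
qed

text \<open>The m - 1 inner vertices form a clique with the first vertex, so they avoid its colour
  \<open>i\<close>; the m - k neighbours of the last vertex also avoid \<open>j\<close>. If i = j
  the second condition is implied by the first.\<close>

lemma transfer_ice_cream:
  assumes C: "finite C" "j \<in> C" and m: "2 \<le> m" "1 \<le> k" "k \<le> m" and n: "1 \<le> n"
  shows "transfer C x n (ice_cream (Suc m) k) i j = ehat x (m - 1) (C - {i})
    - (if i \<noteq> j then of_nat (m - k) * x j * ehat x (m - 2) (C - {i} - {j}) else 0)"
proof -
  \<comment> \<open>\<open>?S\<close> lies inside \<open>?T\<close> because k >= 1: the first and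
    last vertices of the scoop are not adjacent and may share a colour.\<close>
  let ?T = "{n + 1..<n + m}" and ?S = "{n + k..<n + m}" and ?s = "\<lambda>a. n - 1 + a"
  have im: "?s ` {1..m} = insert n ?T" "?s ` {Suc k..m} = ?S"
    unfolding image_add_atLeastAtMost using n m by auto
  have pt: "shifted_proper n (ice_cream (Suc m) k) (\<kappa>(n := i, n + m := j))
      \<longleftrightarrow> inj_on \<kappa> ?T \<and> \<kappa> ` ?T \<subseteq> C - {i} \<and> j \<notin> \<kappa> ` ?S" if "\<kappa> \<in> ?T \<rightarrow>\<^sub>E C" for \<kappa>
  proof -
    let ?k = "\<kappa>(n := i, n + m := j)"
    have "inj_on ?s {1..m}" by simp
    then have "inj_on (\<lambda>a. ?k (?s a)) {1..m} \<longleftrightarrow> inj_on ?k (insert n ?T)"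
      using comp_inj_on_iff[of ?s "{1..m}" ?k] unfolding im comp_def by blast
    also have "\<dots> \<longleftrightarrow> inj_on \<kappa> ?T \<and> i \<notin> \<kappa> ` ?T"
    proof -
      have "inj_on ?k ?T = inj_on \<kappa> ?T" by (intro inj_on_cong) auto
      moreover have "?k ` ?T = \<kappa> ` ?T" by (intro image_cong) auto
      moreover have "?k n = i" using m by simp
      ultimately show ?thesis unfolding inj_on_insert by (simp del: fun_upd_apply)
    qed
    also have "i \<notin> \<kappa> ` ?T \<longleftrightarrow> \<kappa> ` ?T \<subseteq> C - {i}" using that by auto
    finally have 1: "inj_on (\<lambda>a. ?k (?s a)) {1..m} \<longleftrightarrow> inj_on \<kappa> ?T \<and> \<kappa> ` ?T \<subseteq> C - {i}" .
    have "(\<lambda>a. ?k (?s a)) ` {Suc k..m} = ?k ` ?S" unfolding im(2)[symmetric] image_image ..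
    also have "\<dots> = \<kappa> ` ?S" using m(2) by (intro image_cong) auto
    finally have 2: "(\<lambda>a. ?k (?s a)) ` {Suc k..m} = \<kappa> ` ?S" .
    have "?k (?s (Suc m)) = j" using n by simp
    then show ?thesis unfolding shifted_proper_def proper_ice_cream 1 2 by (simp del: fun_upd_apply)
  qed
  have verts: "n + nverts (ice_cream (Suc m) k) - 1 = n + m"
    by (simp add: ice_cream_def)
  have "transfer C x n (ice_cream (Suc m) k) i j
      = wsum C x ?T (\<lambda>\<kappa>. of_bool (inj_on \<kappa> ?T \<and> \<kappa> ` ?T \<subseteq> C - {i} \<and> j \<notin> \<kappa> ` ?S))"
    unfolding transfer_def Let_def verts by (rule wsum_cong) (simp only: pt)
  also have "\<dots> = ehat x (card ?T) (C - {i}) - (if j \<in> C - {i}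
      then of_nat (card ?S) * x j * ehat x (card ?T - 1) (C - {i} - {j}) else 0)"
    using C m by (intro wsum_inj_avoiding) auto
  also have "card ?T = m - 1" by simp
  also have "card ?S = m - k" by simp
  finally show ?thesis using C by (auto simp: numeral_2_eq_2)
qed

text \<open>Reversal exchanges the roles of \<open>i\<close> and \<open>j\<close>: the inner
  vertices form a clique with the last vertex, and m - k of them are adjacent to the shared
  one.\<close>

lemma transfer_reverse_ice_cream:
  assumes C: "finite C" "i \<in> C" and m: "2 \<le> m" "1 \<le> k" "k \<le> m" and n: "1 \<le> n"
  shows "transfer C x n (reverse_graph (ice_cream (Suc m) k)) i j = ehat x (m - 1) (C - {j})
    - (if i \<noteq> j then of_nat (m - k) * x i * ehat x (m - 2) (C - {j} - {i}) else 0)"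
proof -
  let ?T = "{n + 1..<n + m}" and ?S = "{n + 1..<n + m + 1 - k}" and ?s = "\<lambda>a. n - 1 + a"
  have im: "?s ` {2..Suc m} = insert (n + m) ?T" "?s ` {2..Suc m - k} = ?S"
    unfolding image_add_atLeastAtMost using n m by auto
  have pt: "shifted_proper n (reverse_graph (ice_cream (Suc m) k)) (\<kappa>(n := i, n + m := j))
      \<longleftrightarrow> inj_on \<kappa> ?T \<and> \<kappa> ` ?T \<subseteq> C - {j} \<and> i \<notin> \<kappa> ` ?S" if "\<kappa> \<in> ?T \<rightarrow>\<^sub>E C" for \<kappa>
  proof -
    let ?k = "\<kappa>(n := i, n + m := j)"
    have "inj_on ?s {2..Suc m}" by simp
    then have "inj_on (\<lambda>a. ?k (?s a)) {2..Suc m} \<longleftrightarrow> inj_on ?k (insert (n + m) ?T)"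
      using comp_inj_on_iff[of ?s "{2..Suc m}" ?k] unfolding im comp_def by blast
    also have "\<dots> \<longleftrightarrow> inj_on \<kappa> ?T \<and> j \<notin> \<kappa> ` ?T"
    proof -
      have "inj_on ?k ?T = inj_on \<kappa> ?T" by (intro inj_on_cong) auto
      moreover have "?k ` ?T = \<kappa> ` ?T" by (intro image_cong) auto
      moreover have "?k (n + m) = j" by simp
      ultimately show ?thesis unfolding inj_on_insert by (simp del: fun_upd_apply)
    qed
    also have "j \<notin> \<kappa> ` ?T \<longleftrightarrow> \<kappa> ` ?T \<subseteq> C - {j}" using that by auto
    finally have 1: "inj_on (\<lambda>a. ?k (?s a)) {2..Suc m} \<longleftrightarrow> inj_on \<kappa> ?T \<and> \<kappa> ` ?T \<subseteq> C - {j}" .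
    have "(\<lambda>a. ?k (?s a)) ` {2..Suc m - k} = ?k ` ?S" unfolding im(2)[symmetric] image_image ..
    also have "\<dots> = \<kappa> ` ?S" using m(2) by (intro image_cong) auto
    finally have 2: "(\<lambda>a. ?k (?s a)) ` {2..Suc m - k} = \<kappa> ` ?S" .
    have "?k (?s 1) = i" using n m by simp
    then show ?thesis
      unfolding shifted_proper_def proper_reverse_ice_cream[OF m(3)] 1 2 by (simp del: fun_upd_apply)
  qed
  have verts: "n + nverts (reverse_graph (ice_cream (Suc m) k)) - 1 = n + m"
    by (simp add: ice_cream_def reverse_graph_def)
  have "transfer C x n (reverse_graph (ice_cream (Suc m) k)) i j
      = wsum C x ?T (\<lambda>\<kappa>. of_bool (inj_on \<kappa> ?T \<and> \<kappa> ` ?T \<subseteq> C - {j} \<and> i \<notin> \<kappa> ` ?S))"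
    unfolding transfer_def Let_def verts by (rule wsum_cong) (simp only: pt)
  also have "\<dots> = ehat x (card ?T) (C - {j}) - (if i \<in> C - {j}
      then of_nat (card ?S) * x i * ehat x (card ?T - 1) (C - {j} - {i}) else 0)"
    using C m by (intro wsum_inj_avoiding) auto
  also have "card ?T = m - 1" by simp
  also have "card ?S = m - k" using m by simp
  finally show ?thesis using C by (auto simp: numeral_2_eq_2)
qed

section \<open>Signs of the coefficients\<close>

definition glue_coeff :: "nat \<Rightarrow> nat \<Rightarrow> nat \<Rightarrow> int" where
  "glue_coeff p q c = (if c \<le> p then int q + 1 - int c else 0) + (if q + 2 \<le> c then int c - int q - 1 else 0)"

text \<open>The first summand is negative only for q + 1 < c <= p, and there the second summand
  cancels it exactly.\<close>

lemma glue_coeff_nonneg: "0 \<le> glue_coeff p q c"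
  by (auto simp: glue_coeff_def)

lemma esym_product_in_cone:
  assumes "0 \<notin># la" "sum_mset la + c + b + 1 = d"
  shows "(\<lambda>x j. (\<Prod>r\<in>#la. ehat x r C) * (esym x c C * esym x b (C - {j}))) \<in> e_cone C d"
proof -
  \<comment> \<open>A factor e_0 = 1 must not create a part 0. The last block gets size b + 1, as it
    contains the last vertex besides the \<open>b\<close> others.\<close>
  let ?la = "la + filter_mset (\<lambda>r. r \<noteq> 0) {#c#}"
  have "(?la, b + 1) \<in> type_index d" using assms by (auto simp: type_index_def)
  then have "(\<lambda>x j. (1 / (fact c * fact b)) * e_term C x j (?la, b + 1)) \<in> e_cone C d"
    by (intro e_cone_scale e_cone_e_term) auto
  moreover have "(1 / (fact c * fact b)) * e_term C x j (?la, b + 1)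
      = (\<Prod>r\<in>#la. ehat x r C) * (esym x c C * esym x b (C - {j}))" for x j
    by (auto simp: e_term_def esym_def)
  ultimately show ?thesis by simp
qed

text \<open>Both factors become ordinary blocks, and the last vertex forms a block of size 1, whose
  factor is e_0 = 1.\<close>

lemma esym_product_in_cone':
  assumes "0 \<notin># la" "sum_mset la + c + b + 1 = d"
  shows "(\<lambda>x j. (\<Prod>r\<in>#la. ehat x r C) * (esym x c C * esym x b C)) \<in> e_cone C d"
proof -
  let ?la = "la + filter_mset (\<lambda>r. r \<noteq> 0) {#c#}"
  have "(\<lambda>x j. (1 / fact c) * ((\<Prod>r\<in>#?la. ehat x r C) * (esym x b C * esym x 0 (C - {j})))) \<in> e_cone C d"
    using assms by (intro e_cone_scale esym_product_in_cone) auto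
  moreover have "(1 / fact c) * ((\<Prod>r\<in>#?la. ehat x r C) * (esym x b C * esym x 0 (C - {j})))
      = (\<Prod>r\<in>#la. ehat x r C) * (esym x c C * esym x b C)" for x j
    by (auto simp: esym_def)
  ultimately show ?thesis by simp
qed

lemma sum_reverse_average:
  fixes f :: "nat \<Rightarrow> rat"
  assumes "\<And>c. c \<le> N \<Longrightarrow> f (N - c) = f c"
  shows "(\<Sum>c\<le>N. a c * f c) = (\<Sum>c\<le>N. (a c + a (N - c)) / 2 * f c)"
proof -
  have "(\<Sum>c\<le>N. a c * f c) = (\<Sum>c\<le>N. a (N - c) * f (N - c))"
    by (rule sum.reindex_bij_witness[where i = "\<lambda>c. N - c" and j = "\<lambda>c. N - c"]) auto
  also have "\<dots> = (\<Sum>c\<le>N. a (N - c) * f c)" using assms by (intro sum.cong) auto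
  finally have "2 * (\<Sum>c\<le>N. a c * f c) = (\<Sum>c\<le>N. a c * f c) + (\<Sum>c\<le>N. a (N - c) * f c)" by simp
  also have "\<dots> = 2 * (\<Sum>c\<le>N. (a c + a (N - c)) / 2 * f c)"
    unfolding sum_distrib_left sum.distrib[symmetric] by (intro sum.cong) (auto simp: field_simps)
  finally show ?thesis by simp
qed

text \<open>The coefficient of e_c(X) e_(N-c)(X) with N = p + q + 2. The first part comes from
  \<open>sum_esym_esym\<close>, the second from rewriting x_j e_(N-1-c)(X - x_j), which occurs only
  for c < N.\<close>

definition scoop_coeff :: "nat \<Rightarrow> nat \<Rightarrow> nat \<Rightarrow> nat \<Rightarrow> int" where
  "scoop_coeff p q s c = (if c \<le> p then (int q + 1) * (int (p + q + 2) - 2 * int c) else 0)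
     - (if c \<le> p + q + 1 then int s * glue_coeff p q c else 0)"

lemma scoop_coeff_pair_nonneg:
  assumes s: "s \<le> q + 1" and c: "c \<le> p + q + 2"
  shows "0 \<le> scoop_coeff p q s c + scoop_coeff p q s (p + q + 2 - c)"
proof -
  define N where "N = p + q + 2"
  \<comment> \<open>Replacing c by N - c exchanges the conditions c <= p and q + 2 <= c. Hence both
    parts yield the same sum, once with factor q + 1 and once with factor s.\<close>
  have middle: "scoop_coeff p q s c + scoop_coeff p q s (N - c)
      = (int q + 1 - int s) * ((int N - 2 * int c) * (of_bool (c \<le> p) - of_bool (q + 2 \<le> c)))"
    if "0 < c" "c < N" for c
    using that unfolding N_def scoop_coeff_def glue_coeff_def
    by (cases "c \<le> p"; cases "q + 2 \<le> c") (auto simp: algebra_simps of_nat_diff)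
  \<comment> \<open>The ends are separate because the subtracted part is cut off at c = N.\<close>
  have ends: "scoop_coeff p q s 0 + scoop_coeff p q s N = (int q + 1) * (int N - int s)"
    unfolding N_def scoop_coeff_def glue_coeff_def by (auto simp: algebra_simps)
  have "0 \<le> (int q + 1) * (int N - int s)" using s by (simp add: N_def)
  then have ends_nonneg: "0 \<le> scoop_coeff p q s 0 + scoop_coeff p q s N" unfolding ends .
  have "0 \<le> scoop_coeff p q s c + scoop_coeff p q s (N - c)" if cN: "c \<le> N" for c
  proof -
    consider "c = 0" | "c = N" | "0 < c" "c < N" using cN by linarith
    then show ?thesis
    proof cases
      case 1
      then show ?thesis using ends_nonneg by simp
    next
      case 2
      then show ?thesis using ends_nonneg by (simp add: add.commute)
    next
      case 3
      have nonneg: "0 \<le> (int N - 2 * int c) * (of_bool (c \<le> p) - of_bool (q + 2 \<le> c))"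
        unfolding N_def by (cases "c \<le> p"; cases "q + 2 \<le> c") auto
      show ?thesis
        unfolding middle[OF 3] by (rule mult_nonneg_nonneg[OF _ nonneg]) (use s in simp)
    qed
  qed
  then show ?thesis using c by (simp add: N_def)
qed

lemma scoop_expansion:
  fixes p q s :: nat
  assumes I: "finite I" "j \<in> I"
  defines "N \<equiv> p + q + 2"
  shows "of_nat (q + 1) * (\<Sum>i\<in>I. x i * esym x p (I - {i}) * esym x (q + 1) (I - {i}))
      - of_nat s * x j * (\<Sum>i\<in>I - {j}. x i * esym x p (I - {i}) * esym x q (I - {j} - {i}))
    = (\<Sum>c\<le>N. of_int (scoop_coeff p q s c + scoop_coeff p q s (N - c)) / 2 * (esym x c I * esym x (N - c) I))
      + (\<Sum>c\<le>p + q + 1. of_int (int s * glue_coeff p q c) * (esym x c I * esym x (N - c) (I - {j})))"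
proof -
  let ?K = "p + q + 1"
  let ?e = "\<lambda>c. esym x c I" and ?g = "\<lambda>c. esym x c (I - {j})" and ?\<rho> = "glue_coeff p q"
  have 1: "of_nat (q + 1) * (\<Sum>i\<in>I. x i * esym x p (I - {i}) * esym x (q + 1) (I - {i}))
      = (\<Sum>c\<le>N. of_int (if c \<le> p then (int q + 1) * (int N - 2 * int c) else 0) * (?e c * ?e (N - c)))"
  proof -
    have "(\<Sum>c\<le>N. of_int (if c \<le> p then (int q + 1) * (int N - 2 * int c) else 0) * (?e c * ?e (N - c)))
       = (\<Sum>c\<le>p. of_int ((int q + 1) * (int N - 2 * int c)) * (?e c * ?e (N - c)))"
      by (rule sum.mono_neutral_cong_right) (auto simp: N_def)
    then show ?thesis
      unfolding sum_esym_esym[OF I(1)] sum_distrib_left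
      by (simp add: N_def algebra_simps)
  qed
  \<comment> \<open>The leftover x_j is absorbed by raising a degree. The part over \<open>I\<close>
    can be negative and is averaged later; the part over \<open>I - {j}\<close> enters with a plus
    sign.\<close>
  have "x j * ?g (?K - c) = ?e (N - c) - ?g (N - c)" if "c \<le> ?K" for c
  proof -
    have "N - c = Suc (?K - c)" using that by (simp add: N_def)
    then show ?thesis using esym_remove[OF I, of x "?K - c"] by simp
  qed
  then have "of_nat s * x j * (\<Sum>i\<in>I - {j}. x i * esym x p (I - {i}) * esym x q (I - {j} - {i}))
      = (\<Sum>c\<le>?K. of_int (int s * ?\<rho> c) * (?e c * (?e (N - c) - ?g (N - c))))"
    unfolding sum_esym_esym_remove[OF I] glue_coeff_def[symmetric] sum_distrib_left
    by (intro sum.cong refl) (simp add: mult_ac)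
  also have "\<dots> = (\<Sum>c\<le>?K. of_int (int s * ?\<rho> c) * (?e c * ?e (N - c)))
      - (\<Sum>c\<le>?K. of_int (int s * ?\<rho> c) * (?e c * ?g (N - c)))"
    by (simp add: right_diff_distrib sum_subtractf)
  also have "(\<Sum>c\<le>?K. of_int (int s * ?\<rho> c) * (?e c * ?e (N - c)))
      = (\<Sum>c\<le>N. of_int (if c \<le> ?K then int s * ?\<rho> c else 0) * (?e c * ?e (N - c)))"
    by (rule sum.mono_neutral_cong_left) (auto simp: N_def)
  finally have 2: "of_nat s * x j * (\<Sum>i\<in>I - {j}. x i * esym x p (I - {i}) * esym x q (I - {j} - {i})) = \<dots>
      - (\<Sum>c\<le>?K. of_int (int s * ?\<rho> c) * (?e c * ?g (N - c)))" .
  have "(\<Sum>c\<le>N. of_int (scoop_coeff p q s c) * (?e c * ?e (N - c)))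
      = (\<Sum>c\<le>N. of_int (scoop_coeff p q s c + scoop_coeff p q s (N - c)) / 2 * (?e c * ?e (N - c)))"
    using sum_reverse_average[of N "\<lambda>c. ?e c * ?e (N - c)" "\<lambda>c. of_int (scoop_coeff p q s c)"]
    by (simp add: mult.commute)
  moreover have "(\<Sum>c\<le>N. of_int (scoop_coeff p q s c) * (?e c * ?e (N - c)))
      = (\<Sum>c\<le>N. of_int (if c \<le> p then (int q + 1) * (int N - 2 * int c) else 0) * (?e c * ?e (N - c)))
        - (\<Sum>c\<le>N. of_int (if c \<le> ?K then int s * ?\<rho> c else 0) * (?e c * ?e (N - c)))"
    unfolding scoop_coeff_def N_def[symmetric] of_int_diff left_diff_distrib sum_subtractf ..
  ultimately show ?thesis unfolding 1 2 by linarith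
qed

text \<open>In the subtracted sum one x_i is absorbed by x_i e_p(X - x_i) = e_(p+1)(X) - e_(p+1)(X -
  x_i). The glue sum for p + 1 thus returns with a plus sign, and a negative contribution remains
  only at c = p + 1.\<close>

lemma reverse_scoop_expansion:
  fixes p q s :: nat
  assumes I: "finite I" "j \<in> I"
  shows "of_nat (q + 1) * esym x (q + 1) (I - {j}) * (\<Sum>i\<in>I. x i * esym x p (I - {i}))
      - of_nat s * (\<Sum>i\<in>I - {j}. x i * x i * esym x p (I - {i}) * esym x q (I - {j} - {i}))
    = (\<Sum>c\<le>p + q + 2. of_int ((if c = p + 1 then (int q + 1) * (int p + 1 - int s) else 0)
        + int s * glue_coeff (p + 1) q c) * (esym x c I * esym x (p + q + 2 - c) (I - {j})))"
proof -
  let ?e = "\<lambda>c. esym x c I" and ?g = "\<lambda>c. esym x c (I - {j})" and ?N = "p + q + 2"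
  let ?U = "\<Sum>i\<in>I - {j}. x i * esym x (Suc p) (I - {i}) * esym x q (I - {j} - {i})"
  have "(\<Sum>i\<in>I - {j}. x i * x i * esym x p (I - {i}) * esym x q (I - {j} - {i}))
      = (\<Sum>i\<in>I - {j}. ?e (Suc p) * (x i * esym x q (I - {j} - {i}))
          - x i * esym x (Suc p) (I - {i}) * esym x q (I - {j} - {i}))"
    by (intro sum.cong) (auto simp: esym_remove[OF I(1), of _ x p] algebra_simps)
  also have "\<dots> = of_nat (q + 1) * ?e (p + 1) * ?g (q + 1) - ?U"
    by (simp add: sum_subtractf sum_distrib_left[symmetric] sum_esym_remove)
  finally have D: "(\<Sum>i\<in>I - {j}. x i * x i * esym x p (I - {i}) * esym x q (I - {j} - {i})) = \<dots>" .
  have U: "?U = (\<Sum>c\<le>?N. of_int (glue_coeff (p + 1) q c) * (?e c * ?g (?N - c)))"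
    using sum_esym_esym_remove[OF I, of x "p + 1" q]
    unfolding glue_coeff_def[symmetric] by (simp add: mult.assoc)
  have "(\<Sum>c\<le>?N. of_int ((if c = p + 1 then (int q + 1) * (int p + 1 - int s) else 0)
        + int s * glue_coeff (p + 1) q c) * (?e c * ?g (?N - c)))
      = (\<Sum>c\<le>?N. if c = p + 1 then of_int ((int q + 1) * (int p + 1 - int s)) * (?e (p + 1) * ?g (q + 1)) else 0)
        + of_nat s * (\<Sum>c\<le>?N. of_int (glue_coeff (p + 1) q c) * (?e c * ?g (?N - c)))"
    unfolding sum_distrib_left sum.distrib[symmetric]
    by (intro sum.cong refl) (auto simp: algebra_simps)
  also have "(\<Sum>c\<le>?N. if c = p + 1 then of_int ((int q + 1) * (int p + 1 - int s)) * (?e (p + 1) * ?g (q + 1)) else 0)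
      = of_int ((int q + 1) * (int p + 1 - int s)) * (?e (p + 1) * ?g (q + 1))"
    by (simp del: sum.atMost_Suc)
  finally show ?thesis
    unfolding D sum_esym_remove U[symmetric] by (simp add: algebra_simps)
qed

text \<open>For p <= q the critical coefficient at c = p + 1 simplifies to (p + 1)(q + 1 - s). For p
  > q already p + 1 - s is positive.\<close>

lemma reverse_scoop_coeff_nonneg:
  assumes "s \<le> q + 1"
  shows "0 \<le> (if c = p + 1 then (int q + 1) * (int p + 1 - int s) else 0) + int s * glue_coeff (p + 1) q c"
proof (cases "c = p + 1 \<and> p \<le> q")
  case True
  then have "(if c = p + 1 then (int q + 1) * (int p + 1 - int s) else 0) + int s * glue_coeff (p + 1) q c
      = (int p + 1) * (int q + 1 - int s)"
    by (simp add: glue_coeff_def algebra_simps)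
  then show ?thesis using assms by simp
next
  case False
  then show ?thesis using glue_coeff_nonneg[of "p + 1" q c] assms by auto
qed

lemma ice_cream_transfer_in_cone:
  assumes C: "finite C" and m: "2 \<le> m" "1 \<le> k" "k \<le> m" and n: "1 \<le> n" and t: "t \<in> type_index n"
  shows "(\<lambda>x j. \<Sum>i\<in>C. x i * e_term C x i t * transfer C x n (ice_cream (Suc m) k) i j) \<in> e_cone C (n + m)"
proof -
  obtain la b where la: "t = (la, b)" "0 \<notin># la" "1 \<le> b" "sum_mset la + b = n"
    using t by (auto simp: type_index_def)
  \<comment> \<open>The block of the last vertex of \<open>G\<close> has \<open>p\<close> further
    vertices, the scoop has \<open>q + 1\<close> inner vertices, and \<open>s\<close> counts the
    edges kept at vertex m + 1 of the scoop.\<close>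
  define p q s N where "p = b - 1" and "q = m - 2" and "s = m - k" and "N = p + q + 2"
  have bm: "b = p + 1" "m = q + 2" and s: "s \<le> q + 1" using la m by (simp_all add: p_def q_def s_def)
  let ?L = "\<lambda>x. \<Prod>r\<in>#la. ehat x r C" and ?f = "fact p * fact q :: rat"
  have size: "sum_mset la + c + (N - c) + 1 = n + m" if "c \<le> N" for c
    using la that by (simp add: bm N_def)
  have "(\<lambda>x j. ?f * ((\<Sum>c\<le>N. of_int (scoop_coeff p q s c + scoop_coeff p q s (N - c)) / 2
          * (?L x * (esym x c C * esym x (N - c) C)))
      + (\<Sum>c\<le>p + q + 1. of_int (int s * glue_coeff p q c) * (?L x * (esym x c C * esym x (N - c) (C - {j}))))))
      \<in> e_cone C (n + m)"
  proof (rule e_cone_scale, rule e_cone_add)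
    show "(\<lambda>x j. \<Sum>c\<le>N. of_int (scoop_coeff p q s c + scoop_coeff p q s (N - c)) / 2
          * (?L x * (esym x c C * esym x (N - c) C))) \<in> e_cone C (n + m)"
    proof (rule e_cone_sum, rule e_cone_scale)
      fix c assume c: "c \<in> {..N}"
      then show "(\<lambda>x j. ?L x * (esym x c C * esym x (N - c) C)) \<in> e_cone C (n + m)"
        using la(2) size by (intro esym_product_in_cone') auto
      show "0 \<le> of_int (scoop_coeff p q s c + scoop_coeff p q s (N - c)) / (2 :: rat)"
        using scoop_coeff_pair_nonneg[OF s, of c p] c by (simp add: N_def del: of_int_add)
    qed
    show "(\<lambda>x j. \<Sum>c\<le>p + q + 1. of_int (int s * glue_coeff p q c)
          * (?L x * (esym x c C * esym x (N - c) (C - {j})))) \<in> e_cone C (n + m)"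
    proof (rule e_cone_sum, rule e_cone_scale)
      fix c assume c: "c \<in> {..p + q + 1}"
      then show "(\<lambda>x j. ?L x * (esym x c C * esym x (N - c) (C - {j}))) \<in> e_cone C (n + m)"
        using la(2) size by (intro esym_product_in_cone) (auto simp: N_def)
      show "0 \<le> (of_int (int s * glue_coeff p q c) :: rat)"
        using glue_coeff_nonneg[of p q c] by simp
    qed
  qed simp
  then show ?thesis
  proof (rule e_cone_cong)
    fix x j assume j: "j \<in> C"
    let ?E = "of_nat (q + 1) * (\<Sum>i\<in>C. x i * esym x p (C - {i}) * esym x (q + 1) (C - {i}))
      - of_nat s * x j * (\<Sum>i\<in>C - {j}. x i * esym x p (C - {i}) * esym x q (C - {j} - {i}))"
    have "(\<Sum>i\<in>C. x i * e_term C x i t * transfer C x n (ice_cream (Suc m) k) i j)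
        = (\<Sum>i\<in>C. ?f * ?L x * (of_nat (q + 1) * (x i * esym x p (C - {i}) * esym x (q + 1) (C - {i}))
            - (if i \<noteq> j then of_nat s * x j * (x i * esym x p (C - {i}) * esym x q (C - {j} - {i})) else 0)))"
    proof (rule sum.cong[OF refl])
      fix i
      \<comment> \<open>The two \<open>ehat\<close> terms carry (q + 1)! and q!; taking out q!
        leaves the factor q + 1 of \<open>scoop_expansion\<close>.\<close>
      have tr: "transfer C x n (ice_cream (Suc m) k) i j = fact q * (of_nat (q + 1) * esym x (q + 1) (C - {i})
          - (if i \<noteq> j then of_nat s * x j * esym x q (C - {j} - {i}) else 0))"
        unfolding transfer_ice_cream[OF C j m n]
        by (simp add: bm s_def ehat_eq_esym Diff_insert[symmetric] insert_commute algebra_simps del: ehat.simps)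
      have e: "e_term C x i t = ?L x * (fact p * esym x p (C - {i}))"
        unfolding la(1) e_term_def fst_conv snd_conv p_def[symmetric] ehat_eq_esym[of x p] ..
      show "x i * e_term C x i t * transfer C x n (ice_cream (Suc m) k) i j
          = ?f * ?L x * (of_nat (q + 1) * (x i * esym x p (C - {i}) * esym x (q + 1) (C - {i}))
            - (if i \<noteq> j then of_nat s * x j * (x i * esym x p (C - {i}) * esym x q (C - {j} - {i})) else 0))"
        unfolding tr e by (simp add: algebra_simps)
    qed
    also have "\<dots> = ?f * ?L x * ?E"
    proof -
      have "(\<Sum>i\<in>C. if i \<noteq> j then of_nat s * x j * (x i * esym x p (C - {i}) * esym x q (C - {j} - {i})) else 0)
          = (\<Sum>i\<in>C - {j}. of_nat s * x j * (x i * esym x p (C - {i}) * esym x q (C - {j} - {i})))"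
        using C by (intro sum.mono_neutral_cong_right) auto
      then show ?thesis by (simp only: sum_distrib_left[symmetric] sum_subtractf)
    qed
    finally show "?f * ((\<Sum>c\<le>N. of_int (scoop_coeff p q s c + scoop_coeff p q s (N - c)) / 2
          * (?L x * (esym x c C * esym x (N - c) C)))
      + (\<Sum>c\<le>p + q + 1. of_int (int s * glue_coeff p q c) * (?L x * (esym x c C * esym x (N - c) (C - {j})))))
      = (\<Sum>i\<in>C. x i * e_term C x i t * transfer C x n (ice_cream (Suc m) k) i j)"
      unfolding scoop_expansion[OF C j] N_def[symmetric]
      by (simp only: distrib_left sum_distrib_left mult_ac)
  qed
qed

text \<open>The subtracted part has x_i squared: once for the shared vertex and once for a neighbour
  given the same colour. So no x_j is left over, and no averaging is called for.\<close>

lemma reverse_ice_cream_transfer_in_cone: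
  assumes C: "finite C" and m: "2 \<le> m" "1 \<le> k" "k \<le> m" and n: "1 \<le> n" and t: "t \<in> type_index n"
  shows "(\<lambda>x j. \<Sum>i\<in>C. x i * e_term C x i t * transfer C x n (reverse_graph (ice_cream (Suc m) k)) i j)
    \<in> e_cone C (n + m)"
proof -
  obtain la b where la: "t = (la, b)" "0 \<notin># la" "1 \<le> b" "sum_mset la + b = n"
    using t by (auto simp: type_index_def)
  define p q s where "p = b - 1" and "q = m - 2" and "s = m - k"
  have bm: "b = p + 1" "m = q + 2" and s: "s \<le> q + 1" using la m by (simp_all add: p_def q_def s_def)
  let ?L = "\<lambda>x. \<Prod>r\<in>#la. ehat x r C" and ?f = "fact p * fact q :: rat" and ?N = "p + q + 2"
  let ?c = "\<lambda>c. (if c = p + 1 then (int q + 1) * (int p + 1 - int s) else 0) + int s * glue_coeff (p + 1) q c"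
  have "(\<lambda>x j. ?f * (\<Sum>c\<le>?N. of_int (?c c) * (?L x * (esym x c C * esym x (?N - c) (C - {j})))))
      \<in> e_cone C (n + m)"
  proof (rule e_cone_scale, rule e_cone_sum, rule e_cone_scale)
    fix c assume c: "c \<in> {..?N}"
    then show "(\<lambda>x j. ?L x * (esym x c C * esym x (?N - c) (C - {j}))) \<in> e_cone C (n + m)"
      using la by (intro esym_product_in_cone) (auto simp: bm)
    show "0 \<le> (of_int (?c c) :: rat)"
      using reverse_scoop_coeff_nonneg[OF s, of c p] by (simp only: of_int_0_le_iff)
  qed simp
  then show ?thesis
  proof (rule e_cone_cong)
    fix x j assume j: "j \<in> C"
    let ?E = "of_nat (q + 1) * esym x (q + 1) (C - {j}) * (\<Sum>i\<in>C. x i * esym x p (C - {i}))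
      - of_nat s * (\<Sum>i\<in>C - {j}. x i * x i * esym x p (C - {i}) * esym x q (C - {j} - {i}))"
    have "(\<Sum>i\<in>C. x i * e_term C x i t * transfer C x n (reverse_graph (ice_cream (Suc m) k)) i j)
        = (\<Sum>i\<in>C. ?f * ?L x * (of_nat (q + 1) * esym x (q + 1) (C - {j}) * (x i * esym x p (C - {i}))
            - (if i \<noteq> j then of_nat s * (x i * x i * esym x p (C - {i}) * esym x q (C - {j} - {i})) else 0)))"
    proof (rule sum.cong[OF refl])
      fix i assume i: "i \<in> C"
      have tr: "transfer C x n (reverse_graph (ice_cream (Suc m) k)) i j
          = fact q * (of_nat (q + 1) * esym x (q + 1) (C - {j})
          - (if i \<noteq> j then of_nat s * x i * esym x q (C - {j} - {i}) else 0))"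
        unfolding transfer_reverse_ice_cream[OF C i m n]
        by (simp add: bm s_def ehat_eq_esym algebra_simps del: ehat.simps)
      have e: "e_term C x i t = ?L x * (fact p * esym x p (C - {i}))"
        unfolding la(1) e_term_def fst_conv snd_conv p_def[symmetric] ehat_eq_esym[of x p] ..
      show "x i * e_term C x i t * transfer C x n (reverse_graph (ice_cream (Suc m) k)) i j
          = ?f * ?L x * (of_nat (q + 1) * esym x (q + 1) (C - {j}) * (x i * esym x p (C - {i}))
            - (if i \<noteq> j then of_nat s * (x i * x i * esym x p (C - {i}) * esym x q (C - {j} - {i})) else 0))"
        unfolding tr e by (simp add: algebra_simps)
    qed
    also have "\<dots> = ?f * ?L x * ?E"
    proof -
      have "(\<Sum>i\<in>C. if i \<noteq> j then of_nat s * (x i * x i * esym x p (C - {i}) * esym x q (C - {j} - {i})) else 0)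
          = (\<Sum>i\<in>C - {j}. of_nat s * (x i * x i * esym x p (C - {i}) * esym x q (C - {j} - {i})))"
        using C by (intro sum.mono_neutral_cong_right) auto
      then show ?thesis by (simp only: sum_distrib_left[symmetric] sum_subtractf)
    qed
    finally show "?f * (\<Sum>c\<le>?N. of_int (?c c) * (?L x * (esym x c C * esym x (?N - c) (C - {j}))))
      = (\<Sum>i\<in>C. x i * e_term C x i t * transfer C x n (reverse_graph (ice_cream (Suc m) k)) i j)"
      unfolding reverse_scoop_expansion[OF C j]
      by (simp only: distrib_left sum_distrib_left mult_ac)
  qed
qed

theorem proposition5p5:
  fixes n k :: nat
  assumes "2 \<le> n" and "1 \<le> k" and "k \<le> n"
  shows "appendable_e_positive (ice_cream (n + 1) k)
       \<and> appendable_e_positive (reverse_graph (ice_cream (n + 1) k))"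
proof
  have verts: "nverts (ice_cream (Suc n) k) = Suc n" "nverts (reverse_graph (ice_cream (Suc n) k)) = Suc n"
    by (simp_all add: ice_cream_def reverse_graph_def)
  have lab: "labelled_graph (ice_cream (n + 1) k)"
    using labelled_ice_cream by simp
  show "appendable_e_positive (ice_cream (n + 1) k)"
    using ice_cream_transfer_in_cone[OF _ assms] assms(1)
    by (intro appendable_if_transfer[OF lab]) (simp_all add: verts)
  show "appendable_e_positive (reverse_graph (ice_cream (n + 1) k))"
    using reverse_ice_cream_transfer_in_cone[OF _ assms] assms(1)
    by (intro appendable_if_transfer[OF labelled_reverse[OF lab]]) (simp_all add: verts)
qed

end
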